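(* Let $\Gamma$ be a closed curve and $\overline{\mathrm D}$ the closure of the Dirac operator on the hypersurface $(M^3_{A\Gamma},h_t)$, endowed with the trivial spin structure, where $t\neq0$ and $A\in U(2)$. Then, for arbitrary $\delta>0$, $$\inf\{\lambda:\lambda\in\sigma(\overline{\mathrm D}^2)\}<\delta,$$ and $0\in\sigma(\overline{\mathrm D})$.
   Context: Eguchi--Hanson space: $T^*\mathbb P^1(\mathbb C)$ is realized as $H^2=\{(\alpha,\beta,\gamma)\in(\mathbb C^2\setminus\{0\})\times\mathbb C\}/\sim$, where $(\alpha,\beta,\gamma)\sim(A\alpha,A\beta,\gamma/A^2)$ for $A\in\mathbb C^*$; the projection is $p([\alpha,\beta,\gamma])=\alpha/\beta\in\mathbb C\cup\{\infty\}=\mathbb P^1(\mathbb C)$. $M^4\subset H^2$ is the complement of the zero section $\{\gamma=0\}$, identified with $(\mathbb C^2\setminus\{0\})/\{\pm1\}$ by $[\alpha,\beta,\gamma]\mapsto \pm(z_1,z_2)=\pm(\alpha\sqrt\gamma,\beta\sqrt\gamma)$. Put $u_1=|z_1|^2+|z_2|^2$ and $f_t=\sqrt{u_1^2+t^4}+t^2\log\frac{u_1}{\sqrt{u_1^2+t^4}+t^2}$. The form $\omega_t=i\partial\bar\partial f_t$ extends to a Kähler form on $H^2$, and $g_t(X,Y)=\omega_t(X,JY)$ is the Eguchi--Hanson metric ($J$ the complex structure). For a smooth curve $\Gamma(s)=r(s)e^{i\phi_\Gamma(s)}$ in $\mathbb C$ parametrized by Euclidean arc length, $M^3_\Gamma=p^{-1}(\Gamma)\subset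 H^2$ with the metric $h_t$ induced by $g_t$; for closed $\Gamma$ and $t\ne0$ it is complete. $U(2)$ acts on $\mathbb C\cup\{\infty\}$ by Möbius transforms, and isometrically on $(H^2,g_t)$ (by the linear action on $(z_1,z_2)$), so $M^3_\Gamma$ and $M^3_{A\Gamma}$ are isometric. Trivial spin structure: for closed $\Gamma$, $M^3_\Gamma$ admits two spin structures; the trivial one is characterized in the paper by the existence of a global trivialization of the $\mathrm{Spin}(3)$-principal bundle covering an orthonormal frame bundle trivialization (the other admits such a trivialization only locally). It is realized by the orthonormal frame on $M^3_\Gamma\cap M^4$, in coordinates $\pm(z_1,z_2)=\pm\rho e^{i\phi}(\Gamma(s),1)$: $Y_1=h_{22}^{-1/2}\partial_\rho$, $Y_2=h_{33}^{-1/2}\partial_\phi$, $Y_3=\Sigma(h_{22}\partial_s-h_{12}\partial_\rho-\rho^{-2}h_{13}\partial_\phi)$, where $K=\frac{2\rho^2(r^2+1)}{\sqrt{\rho^4(r^2+1)^2+t^4}}$, $h_{12}=r\dot r\rho K$, $h_{13}=\dot\phi_\Gamma r^2\rho^2K$, $h_{22}=(r^2+1)K$, $h_{33}=\rho^2h_{22}$, $\Sigma=1/(2\rho\sqrt{h_{22}})$, spinors being written as $\mathbb C^2$-valued functions. The Dirac operator $\mathrm D\psi=\sum_iY_i\cdot\nabla_{Y_i}\psi$ is considered as an unbounded operator in $L^2$ of the spinor bundle with domain the compactly supported smooth sections; it is essentially self-adjoint since the manifold is complete. *)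

theory Defs
  imports "HOL-Analysis.Analysis"
begin

section \<open>Smooth maps and closed curves\<close>

fun C_times :: "nat \<Rightarrow> ('a::euclidean_space \<Rightarrow> 'b::real_normed_vector) \<Rightarrow> bool" where
  "C_times 0 f \<longleftrightarrow> continuous_on UNIV f"
| "C_times (Suc k) f \<longleftrightarrow> (\<forall>x. f differentiable (at x)) \<and>
     (\<forall>v. C_times k (\<lambda>x. frechet_derivative f (at x) v))"

definition smooth :: "('a::euclidean_space \<Rightarrow> 'b::real_normed_vector) \<Rightarrow> bool" where
  "smooth f \<longleftrightarrow> (\<forall>k. C_times k f)"

text \<open>Closed curves in the plane, parametrized by Euclidean arc length and given as periodic
  functions on the line with period \<open>L\<close>.  Self-intersections are allowed.\<close>

definition closed_curve :: "(real \<Rightarrow> complex) \<Rightarrow> real \<Rightarrow> bool" where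
  "closed_curve \<Gamma> L \<longleftrightarrow> L > 0 \<and> smooth \<Gamma> \<and>
     (\<forall>s. norm (vector_derivative \<Gamma> (at s)) = 1) \<and> (\<forall>s. \<Gamma> (s + L) = \<Gamma> s)"

definition unitary :: "complex^'n^'n \<Rightarrow> bool" where
  "unitary A \<longleftrightarrow> (\<chi> i j. cnj (A $ j $ i)) ** A = mat 1 \<and> A ** (\<chi> i j. cnj (A $ j $ i)) = mat 1"


section \<open>The space \<open>H\<^sup>2\<close> and the hypersurfaces over curves\<close>

text \<open>A pair \<open>(v, c)\<close> stands for the triple of homogeneous coordinates
  \<open>(\<alpha>, \<beta>, \<gamma>) = (v $ 1, v $ 2, c)\<close>.\<close>

type_synonym hom_coords = "(complex^2) \<times> complex"

definition hclass :: "hom_coords \<Rightarrow> hom_coords set" where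
  "hclass x = {(a *s fst x, snd x / a\<^sup>2) | a. a \<noteq> 0}"

definition H2 :: "hom_coords set set" where
  "H2 = hclass ` {x. fst x \<noteq> 0}"

text \<open>The projective line is \<open>complex option\<close>, with \<open>None\<close> as the point at infinity.\<close>

definition ratio :: "complex^2 \<Rightarrow> complex option" where
  "ratio v = (if v $ 2 = 0 then None else Some (v $ 1 / v $ 2))"

definition H2_proj :: "hom_coords set \<Rightarrow> complex option" where
  "H2_proj q = (THE \<zeta>. \<exists>x\<in>q. ratio (fst x) = \<zeta>)"

fun P1_moebius :: "complex^2^2 \<Rightarrow> complex option \<Rightarrow> complex option" where
  "P1_moebius A (Some \<zeta>) = ratio (vector [A $ 1 $ 1 * \<zeta> + A $ 1 $ 2, A $ 2 $ 1 * \<zeta> + A $ 2 $ 2])"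
| "P1_moebius A None = ratio (vector [A $ 1 $ 1, A $ 2 $ 1])"

definition hypersurface :: "complex^2^2 \<Rightarrow> (real \<Rightarrow> complex) \<Rightarrow> hom_coords set set" where
  "hypersurface A \<Gamma> = {q \<in> H2. H2_proj q \<in> P1_moebius A ` range (Some \<circ> \<Gamma>)}"

text \<open>The hypersurface over \<open>A\<Gamma>\<close> is parametrized by \<open>(s, w) \<mapsto> [A(\<Gamma>(s),1), w]\<close>, which also makes
  sense where \<open>A\<Gamma>\<close> passes through infinity; the coordinate \<open>s\<close> is taken modulo \<open>L\<close>.  Off the zero
  section \<open>w = \<rho>\<^sup>2 e\<^bsup>2i\<phi>\<^esup>\<close> corresponds to \<open>\<plusminus>(z\<^sub>1,z\<^sub>2) = \<plusminus>\<rho> e\<^bsup>i\<phi>\<^esup> A(\<Gamma>(s),1)\<close>.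
  For a curve with self-intersections this describes the immersed hypersurface.\<close>

type_synonym chart = "real \<times> complex"

definition lift_param :: "complex^2^2 \<Rightarrow> (real \<Rightarrow> complex) \<Rightarrow> chart \<Rightarrow> hom_coords" where
  "lift_param A \<Gamma> x = (A *v vector [\<Gamma> (fst x), 1], snd x)"

lemma unitary_kernel:
  fixes A :: "complex^'n^'n"
  assumes "unitary A" and "A *v x = 0"
  shows "x = 0"
proof -
  have "x = ((\<chi> i j. cnj (A $ j $ i)) ** A) *v x"
    using assms(1) by (simp add: unitary_def)
  also have "\<dots> = 0"
    using assms(2) by (simp flip: matrix_vector_mul_assoc)
  finally show ?thesis .
qed

lemma ratio_eq_iff:
  assumes "u \<noteq> 0" and "v \<noteq> 0"
  shows "ratio u = ratio v \<longleftrightarrow> (\<exists>a. a \<noteq> 0 \<and> u = a *s v)"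
proof
  assume eq: "ratio u = ratio v"
  have u: "u $ 1 \<noteq> 0 \<or> u $ 2 \<noteq> 0" and v: "v $ 1 \<noteq> 0 \<or> v $ 2 \<noteq> 0"
    using assms by (auto simp: vec_eq_iff forall_2)
  show "\<exists>a. a \<noteq> 0 \<and> u = a *s v"
  proof (cases "v $ 2 = 0")
    case True
    with eq have "u $ 2 = 0" by (auto simp: ratio_def split: if_splits)
    with True u v show ?thesis
      by (intro exI[of _ "u $ 1 / v $ 1"]) (auto simp: vec_eq_iff forall_2)
  next
    case False
    with eq have "u $ 2 \<noteq> 0" and "u $ 1 / u $ 2 = v $ 1 / v $ 2"
      by (auto simp: ratio_def split: if_splits)
    with False show ?thesis
      by (intro exI[of _ "u $ 2 / v $ 2"]) (auto simp: vec_eq_iff forall_2 field_simps)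
  qed
next
  assume "\<exists>a. a \<noteq> 0 \<and> u = a *s v"
  then show "ratio u = ratio v" by (auto simp: ratio_def)
qed

lemma H2_proj_hclass: "H2_proj (hclass x) = ratio (fst x)"
proof -
  have r: "ratio (a *s fst x) = ratio (fst x)" if "a \<noteq> 0" for a
    using that by (auto simp: ratio_def)
  have "x \<in> hclass x"
    by (auto simp: hclass_def intro!: exI[of _ 1] prod_eqI)
  then show ?thesis
    unfolding H2_proj_def by (intro the_equality) (auto simp: hclass_def r)
qed

lemma fst_lift_param_neq_0:
  assumes "unitary A"
  shows "fst (lift_param A \<Gamma> x) \<noteq> 0"
proof
  assume "fst (lift_param A \<Gamma> x) = 0"
  then have "vector [\<Gamma> (fst x), 1] = (0 :: complex^2)"
    using unitary_kernel[OF assms] by (simp add: lift_param_def)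
  then have "(vector [\<Gamma> (fst x), 1] :: complex^2) $ 2 = 0" by simp
  then show False by simp
qed

lemma ratio_lift_param: "ratio (fst (lift_param A \<Gamma> x)) = P1_moebius A (Some (\<Gamma> (fst x)))"
  by (simp add: lift_param_def ratio_def matrix_vector_mult_def sum_2)

lemma hclass_scale:
  assumes "a \<noteq> 0"
  shows "hclass (a *s v, c) = hclass (v, a\<^sup>2 * c)"
proof -
  have "(b *s (a *s v), c / b\<^sup>2) \<in> hclass (v, a\<^sup>2 * c)" if "b \<noteq> 0" for b
    using assms that by (auto simp: hclass_def field_simps intro!: exI[of _ "a * b"])
  moreover have "(b *s v, a\<^sup>2 * c / b\<^sup>2) \<in> hclass (a *s v, c)" if "b \<noteq> 0" for b
    using assms that by (auto simp: hclass_def field_simps intro!: exI[of _ "b / a"])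
  ultimately show ?thesis by (auto simp: hclass_def)
qed

theorem hypersurface_eq_range:
  assumes "unitary A"
  shows "hypersurface A \<Gamma> = range (hclass \<circ> lift_param A \<Gamma>)"
proof (intro equalityI subsetI)
  fix q assume "q \<in> hypersurface A \<Gamma>"
  then obtain v c s where q: "q = hclass (v, c)" "v \<noteq> 0" "ratio v = P1_moebius A (Some (\<Gamma> s))"
    by (auto simp: hypersurface_def H2_def H2_proj_hclass)
  let ?u = "fst (lift_param A \<Gamma> (s, 0))"
  have "ratio v = ratio ?u"
    using q(3) by (simp add: ratio_lift_param)
  then obtain a where "a \<noteq> 0" "v = a *s ?u"
    using ratio_eq_iff[OF q(2) fst_lift_param_neq_0[OF assms]] by blast
  then have "q = (hclass \<circ> lift_param A \<Gamma>) (s, a\<^sup>2 * c)"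
    using q(1) by (simp add: hclass_scale lift_param_def)
  then show "q \<in> range (hclass \<circ> lift_param A \<Gamma>)" by blast
next
  fix q assume "q \<in> range (hclass \<circ> lift_param A \<Gamma>)"
  then obtain x where "q = hclass (lift_param A \<Gamma> x)" by auto
  moreover have "H2_proj (hclass (lift_param A \<Gamma> x)) \<in> P1_moebius A ` range (Some \<circ> \<Gamma>)"
    by (metis H2_proj_hclass comp_apply imageI rangeI ratio_lift_param)
  ultimately show "q \<in> hypersurface A \<Gamma>"
    using fst_lift_param_neq_0[OF assms, of \<Gamma> x]
    by (auto simp: hypersurface_def H2_def)
qed

theorem hclass_lift_param_eq_iff:
  assumes "unitary A"
  shows "hclass (lift_param A \<Gamma> (s, w)) = hclass (lift_param A \<Gamma> (s', w'))
     \<longleftrightarrow> \<Gamma> s = \<Gamma> s' \<and> w = w'"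
proof
  assume eq: "hclass (lift_param A \<Gamma> (s, w)) = hclass (lift_param A \<Gamma> (s', w'))"
  have "lift_param A \<Gamma> (s, w) \<in> hclass (lift_param A \<Gamma> (s, w))"
    by (auto simp: hclass_def intro!: exI[of _ 1] prod_eqI)
  with eq obtain a where a: "a \<noteq> 0" "w = w' / a\<^sup>2"
    "A *v vector [\<Gamma> s, 1] = a *s (A *v vector [\<Gamma> s', 1])"
    by (auto simp: hclass_def lift_param_def)
  then have "A *v (vector [\<Gamma> s, 1] - a *s vector [\<Gamma> s', 1]) = 0"
    by (simp add: matrix_vector_mult_diff_distrib vector_scalar_commute)
  then have "vector [\<Gamma> s, 1] - a *s vector [\<Gamma> s', 1] = (0 :: complex^2)"
    by (rule unitary_kernel[OF assms])
  then have "\<Gamma> s = a * \<Gamma> s'" and "a = 1"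
    by (auto simp: vec_eq_iff forall_2)
  with a show "\<Gamma> s = \<Gamma> s' \<and> w = w'" by simp
qed (simp add: lift_param_def)


section \<open>The Eguchi-Hanson metric\<close>

text \<open>Functions and forms on \<open>H\<^sup>2\<close> are represented by their pullbacks to the homogeneous coordinates
  along the holomorphic submersion \<open>hclass\<close>; such pullbacks commute with \<open>i \<partial> \<partial>\<^sup>-\<close>.\<close>

definition zcoords :: "hom_coords \<Rightarrow> complex^2" where
  "zcoords x = csqrt (snd x) *s fst x"

definition EH_potential :: "real \<Rightarrow> hom_coords \<Rightarrow> real" where
  "EH_potential t x =
     (let u = (cmod (zcoords x $ 1))\<^sup>2 + (cmod (zcoords x $ 2))\<^sup>2; q = sqrt (u\<^sup>2 + t ^ 4)
      in q + t\<^sup>2 * ln (u / (q + t\<^sup>2)))"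

lemma EH_potential_cong:
  assumes "hclass x = hclass y"
  shows "EH_potential t x = EH_potential t y"
proof -
  have "x \<in> hclass x"
    by (auto simp: hclass_def intro!: exI[of _ 1] prod_eqI)
  with assms obtain a where a: "a \<noteq> 0" "x = (a *s fst y, snd y / a\<^sup>2)"
    by (auto simp: hclass_def)
  have "(cmod (csqrt c * z))\<^sup>2 = cmod c * (cmod z)\<^sup>2" for c z
    by (simp add: norm_mult power_mult_distrib flip: norm_power)
  with a show ?thesis
    by (simp add: EH_potential_def zcoords_def norm_mult norm_divide norm_power power_mult_distrib)
qed

definition J :: "hom_coords \<Rightarrow> hom_coords" where
  "J X = (\<i> *s fst X, \<i> * snd X)"

text \<open>\<open>d_hol X F = \<Sum>\<^sub>j X\<^sub>j \<partial>F/\<partial>z\<^sub>j\<close> and \<open>d_antihol X F = \<Sum>\<^sub>j cnj X\<^sub>j \<partial>F/\<partial>(cnj z\<^sub>j)\<close> for a constant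
  vector \<open>X\<close>.\<close>

definition d_hol :: "hom_coords \<Rightarrow> (hom_coords \<Rightarrow> complex) \<Rightarrow> hom_coords \<Rightarrow> complex" where
  "d_hol X F p = (frechet_derivative F (at p) X - \<i> * frechet_derivative F (at p) (J X)) / 2"

definition d_antihol :: "hom_coords \<Rightarrow> (hom_coords \<Rightarrow> complex) \<Rightarrow> hom_coords \<Rightarrow> complex" where
  "d_antihol X F p = (frechet_derivative F (at p) X + \<i> * frechet_derivative F (at p) (J X)) / 2"

text \<open>The value of \<open>i \<partial> \<partial>\<^sup>- f\<close> on a pair of vectors is real for a real function \<open>f\<close>.\<close>

definition EH_form :: "real \<Rightarrow> hom_coords \<Rightarrow> hom_coords \<Rightarrow> hom_coords \<Rightarrow> real" where
  "EH_form t p X Y =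
     (let F = (\<lambda>x. complex_of_real (EH_potential t x))
      in Re (\<i> * (d_hol X (d_antihol Y F) p - d_hol Y (d_antihol X F) p)))"

text \<open>The potential is singular along the zero section, to which the form extends continuously
  (in fact smoothly).\<close>

definition EH_metric :: "real \<Rightarrow> hom_coords \<Rightarrow> hom_coords \<Rightarrow> hom_coords \<Rightarrow> real" where
  "EH_metric t p X Y =
     (if snd p \<noteq> 0 then EH_form t p X (J Y)
      else Lim (at p within {x. snd x \<noteq> 0}) (\<lambda>x. EH_form t x X (J Y)))"

type_synonym metric = "chart \<Rightarrow> chart \<Rightarrow> chart \<Rightarrow> real"

definition induced_metric :: "real \<Rightarrow> complex^2^2 \<Rightarrow> (real \<Rightarrow> complex) \<Rightarrow> metric" where
  "induced_metric t A \<Gamma> x X Y =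
     (let dF = frechet_derivative (lift_param A \<Gamma>) (at x)
      in EH_metric t (lift_param A \<Gamma> x) (dF X) (dF Y))"


section \<open>The Dirac operator\<close>

type_synonym vfield = "chart \<Rightarrow> chart"

definition lie_bracket :: "vfield \<Rightarrow> vfield \<Rightarrow> vfield" where
  "lie_bracket X Y x = frechet_derivative Y (at x) (X x) - frechet_derivative X (at x) (Y x)"

text \<open>\<open>levi_civita g X Y Z\<close> is \<open>g(\<nabla>\<^sub>X Y, Z)\<close>, by the Koszul formula.\<close>

definition levi_civita :: "metric \<Rightarrow> vfield \<Rightarrow> vfield \<Rightarrow> vfield \<Rightarrow> chart \<Rightarrow> real" where
  "levi_civita g X Y Z x =
     (frechet_derivative (\<lambda>y. g y (Y y) (Z y)) (at x) (X x)
      + frechet_derivative (\<lambda>y. g y (Z y) (X y)) (at x) (Y x)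
      - frechet_derivative (\<lambda>y. g y (X y) (Y y)) (at x) (Z x)
      + g x (lie_bracket X Y x) (Z x)
      - g x (lie_bracket Y Z x) (X x)
      + g x (lie_bracket Z X x) (Y x)) / 2"

text \<open>The coordinate vectors \<open>\<partial>/\<partial>Re w\<close>, \<open>\<partial>/\<partial>Im w\<close>, \<open>\<partial>/\<partial>s\<close>, in this order.\<close>

definition coord_vec :: "3 \<Rightarrow> chart" where
  "coord_vec i = vector [(0, 1), (0, \<i>), (1, 0)] $ i"

definition normalize_vec :: "metric \<Rightarrow> chart \<Rightarrow> chart \<Rightarrow> chart" where
  "normalize_vec g x X = X /\<^sub>R sqrt (g x X X)"

text \<open>The orthonormal frame obtained from the coordinate vectors by the Gram-Schmidt process.  It is a
  global trivialization of the orthonormal frame bundle, including the zero section.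

  Its relation to the frame \<open>Y\<^sub>1 \<sim> \<partial>\<^sub>\<rho>\<close>, \<open>Y\<^sub>2 \<sim> \<partial>\<^sub>\<phi>\<close>, \<open>Y\<^sub>3\<close> in the coordinates \<open>w = \<rho>\<^sup>2 e\<^bsup>2i\<phi>\<^esup>\<close>:
  since the metric is Hermitian on the complex fibres of the projection, off the zero section
    \<open>Y\<^sub>1 = cos 2\<phi> E\<^sub>1 + sin 2\<phi> E\<^sub>2\<close>,  \<open>Y\<^sub>2 = - sin 2\<phi> E\<^sub>1 + cos 2\<phi> E\<^sub>2\<close>,  \<open>Y\<^sub>3 = E\<^sub>3\<close>.
  The vectors \<open>Y\<^sub>i\<close> themselves do not extend to the zero section, whereas the \<open>E\<^sub>i\<close> do; spinors with
  respect to the two frames differ by the lift of this rotation, \<open>diag(e\<^bsup>\<plusminus>i\<phi>\<^esup>)\<close>.  Along the curve,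
  i.e. for fixed \<open>w\<close>, the rotation is constant, so \<open>E\<close> singles out the spin structure in which the
  lift of \<open>Y\<close> along the curve closes up.  Replacing \<open>w\<close> by the fibre coordinate belonging to another
  nowhere vanishing lift of \<open>A\<Gamma>\<close> multiplies it by a square of a function \<open>S\<^sup>1 \<rightarrow> \<complex>\<^sup>*\<close>, so that
  the spin structure does not depend on this choice.\<close>

definition frame :: "metric \<Rightarrow> 3 \<Rightarrow> vfield" where
  "frame g i x =
     (let E1 = normalize_vec g x (coord_vec 1);
          E2 = normalize_vec g x (coord_vec 2 - g x (coord_vec 2) E1 *\<^sub>R E1);
          E3 = normalize_vec g x (coord_vec 3 - g x (coord_vec 3) E1 *\<^sub>R E1
                                              - g x (coord_vec 3) E2 *\<^sub>R E2)
      in vector [E1, E2, E3] $ i)"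

text \<open>The spinor bundle is trivialized by the frame, so spinors are functions with values in
  \<open>\<complex>\<^sup>2\<close>.  Clifford multiplication is normalized by \<open>e\<^sub>j e\<^sub>k + e\<^sub>k e\<^sub>j = -2 \<delta>\<^sub>j\<^sub>k\<close>, with \<open>e\<^sub>j = i \<sigma>\<^sub>j\<close> for
  the Pauli matrices \<open>\<sigma>\<^sub>j\<close>; the other irreducible representation only changes the sign of the Dirac
  operator.\<close>

type_synonym spinor = "chart \<Rightarrow> complex^2"

definition clifford :: "3 \<Rightarrow> complex^2^2" where
  "clifford j = vector [
     vector [vector [0, \<i>], vector [\<i>, 0]],
     vector [vector [0, 1], vector [-1, 0]],
     vector [vector [\<i>, 0], vector [0, -\<i>]]] $ j"

definition spin_deriv :: "metric \<Rightarrow> 3 \<Rightarrow> spinor \<Rightarrow> spinor" where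
  "spin_deriv g i \<psi> x =
     frechet_derivative \<psi> (at x) (frame g i x)
     + (1/4) *\<^sub>R (\<Sum>j\<in>UNIV. \<Sum>k\<in>UNIV. levi_civita g (frame g i) (frame g j) (frame g k) x
                    *\<^sub>R (clifford j *v (clifford k *v \<psi> x)))"

definition dirac :: "metric \<Rightarrow> spinor \<Rightarrow> spinor" where
  "dirac g \<psi> x = (\<Sum>i\<in>UNIV. clifford i *v spin_deriv g i \<psi> x)"

text \<open>Smooth compactly supported sections: on the closed curve (period \<open>L\<close>) times the fibre \<open>\<complex>\<close>,
  compactness of the support means boundedness in the fibre direction.  Periodicity (rather than
  antiperiodicity) with respect to the frame is the trivial spin structure.\<close>

definition test_spinor :: "real \<Rightarrow> spinor \<Rightarrow> bool" where
  "test_spinor L \<psi> \<longleftrightarrow> smooth \<psi> \<and> (\<forall>s w. \<psi> (s + L, w) = \<psi> (s, w)) \<and>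
     (\<exists>R. \<forall>s w. cmod w > R \<longrightarrow> \<psi> (s, w) = 0)"

text \<open>Unbounded operators are represented by their graphs.\<close>

definition dirac_graph :: "metric \<Rightarrow> real \<Rightarrow> (spinor \<times> spinor) set" where
  "dirac_graph g L = {(\<psi>, dirac g \<psi>) | \<psi>. test_spinor L \<psi>}"

text \<open>The Riemannian volume, carried by one period of the curve.\<close>

definition riem_volume :: "metric \<Rightarrow> real \<Rightarrow> chart measure" where
  "riem_volume g L = density lborel (\<lambda>x. ennreal (indicator ({0..<L} \<times> UNIV) x *
     sqrt (det (\<chi> i j. g x (coord_vec i) (coord_vec j)))))"


section \<open>Closure and spectrum of operators in \<open>L\<^sup>2\<close>\<close>

text \<open>Elements of \<open>L\<^sup>2\<close> are represented by functions, with almost everywhere equal functions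
  identified; the graphs below respect this identification.\<close>

definition L2_sq :: "'a measure \<Rightarrow> ('a \<Rightarrow> complex^2) \<Rightarrow> ennreal" where
  "L2_sq M \<psi> = (\<integral>\<^sup>+x. ennreal ((norm (\<psi> x))\<^sup>2) \<partial>M)"

definition L2_space :: "'a measure \<Rightarrow> ('a \<Rightarrow> complex^2) set" where
  "L2_space M = {\<psi> \<in> borel_measurable M. L2_sq M \<psi> < \<infinity>}"

definition L2_closure ::
  "'a measure \<Rightarrow> (('a \<Rightarrow> complex^2) \<times> ('a \<Rightarrow> complex^2)) set
     \<Rightarrow> (('a \<Rightarrow> complex^2) \<times> ('a \<Rightarrow> complex^2)) set" where
  "L2_closure M T = {(\<psi>, \<eta>). \<psi> \<in> L2_space M \<and> \<eta> \<in> L2_space M \<and>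
     (\<exists>\<psi>' \<eta>'. (\<forall>n::nat. (\<psi>' n, \<eta>' n) \<in> T) \<and>
        (\<lambda>n. L2_sq M (\<lambda>x. \<psi>' n x - \<psi> x)) \<longlonglongrightarrow> 0 \<and>
        (\<lambda>n. L2_sq M (\<lambda>x. \<eta>' n x - \<eta> x)) \<longlonglongrightarrow> 0)}"

text \<open>The resolvent set: \<open>T - \<mu>\<close> is a bijection from the domain of \<open>T\<close> onto \<open>L\<^sup>2\<close> with bounded
  inverse.\<close>

definition L2_resolvent_set ::
  "'a measure \<Rightarrow> (('a \<Rightarrow> complex^2) \<times> ('a \<Rightarrow> complex^2)) set \<Rightarrow> complex set" where
  "L2_resolvent_set M T = {\<mu>.
     (\<forall>\<xi>\<in>L2_space M. \<exists>\<psi> \<eta>. (\<psi>, \<eta>) \<in> T \<and> (AE x in M. \<eta> x - \<mu> *s \<psi> x = \<xi> x)) \<and>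
     (\<exists>C. \<forall>(\<psi>, \<eta>)\<in>T. L2_sq M \<psi> \<le> ennreal C * L2_sq M (\<lambda>x. \<eta> x - \<mu> *s \<psi> x))}"

definition L2_spectrum ::
  "'a measure \<Rightarrow> (('a \<Rightarrow> complex^2) \<times> ('a \<Rightarrow> complex^2)) set \<Rightarrow> complex set" where
  "L2_spectrum M T = - L2_resolvent_set M T"

text \<open>The Dirac operator on the hypersurface over \<open>A\<Gamma>\<close>, for a curve \<open>\<Gamma>\<close> of period \<open>L\<close>, and its
  closure.\<close>

definition EH_volume ::
  "real \<Rightarrow> complex^2^2 \<Rightarrow> (real \<Rightarrow> complex) \<Rightarrow> real \<Rightarrow> chart measure" where
  "EH_volume t A \<Gamma> L = riem_volume (induced_metric t A \<Gamma>) L"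

definition EH_dirac_closure ::
  "real \<Rightarrow> complex^2^2 \<Rightarrow> (real \<Rightarrow> complex) \<Rightarrow> real \<Rightarrow> (spinor \<times> spinor) set" where
  "EH_dirac_closure t A \<Gamma> L =
     L2_closure (EH_volume t A \<Gamma> L) (dirac_graph (induced_metric t A \<Gamma>) L)"

end

(* In the coordinates (s, w) put N = |Gamma|^2 + 1, q = sqrt (N^2 |w|^2 + t^4), Lambda^2 = 2 q / N^2
   and mu = Gamma' cnj Gamma / N.  The induced metric is Lambda^2 ds^2 + |dw + 2 mu w ds|^2 / Lambda^2,
   with volume density 1 / Lambda.  The Gram-Schmidt frame is divergence free and its third vector
   annihilates q, so that the Dirac operator takes the simple form of dirac_eq.  A spinor
   (phi (q / R), 0), with phi a cutoff function supported in [1, Y], is therefore mapped by the square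
   of the Dirac operator to a spinor of size O(1/R) with the same support.  For R -> infinity this
   shows that the square is not bounded below, hence neither is the operator itself, and 0 belongs to
   both spectra. *)

theory Submission
  imports Defs "HOL-Computational_Algebra.Polynomial"
begin

text \<open>The decay rates come from the frame. Where \<open>q\<close> has order R, the vertical
  frame vectors have coordinate length \<Lambda>, of order sqrt R, but a function of
  \<open>q / R\<close> changes only at rate O(1/R) in w; the potential term and the horizontal
  derivatives carry a factor 1 / \<Lambda>. Each application of the operator therefore gains
  R^(-1/2). The support of the spinor and a box on which the cutoff is bounded below both have
  volume of order R^(3/2), so the quotient of the squared norms is of order R^(-2). The spinor may
  be constant along the curve because the trivial spin structure means periodicity in this
  particular frame. Since t is nonzero, \<open>q\<close> is bounded below by t^2, so that metric and
  frame stay smooth across the zero section. One estimate serves both spectra: the operator maps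
  test spinors to test spinors, so a lower bound for it can be applied twice and becomes a lower
  bound for its square.\<close>

section \<open>Smooth functions\<close>

text \<open>Allows the derivative to be given by any explicit formula, so that the inductions below
  work with product and chain rules instead of the choice made by
  \<open>frechet_derivative\<close>.\<close>

lemma C_times_Suc_iff:
  "C_times (Suc k) f \<longleftrightarrow>
     (\<exists>f'. (\<forall>x. (f has_derivative f' x) (at x)) \<and> (\<forall>v. C_times k (\<lambda>x. f' x v)))"
proof
  assume "C_times (Suc k) f"
  then show "\<exists>f'. (\<forall>x. (f has_derivative f' x) (at x)) \<and> (\<forall>v. C_times k (\<lambda>x. f' x v))"
    by (intro exI[of _ "\<lambda>x. frechet_derivative f (at x)"]) (auto simp: frechet_derivative_works)
next
  assume "\<exists>f'. (\<forall>x. (f has_derivative f' x) (at x)) \<and> (\<forall>v. C_times k (\<lambda>x. f' x v))"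
  then obtain f' where f': "\<And>x. (f has_derivative f' x) (at x)" "\<And>v. C_times k (\<lambda>x. f' x v)"
    by blast
  have "frechet_derivative f (at x) = f' x" for x
    using frechet_derivative_at[OF f'(1)] by simp
  then show "C_times (Suc k) f"
    using f' by (auto simp: differentiable_def)
qed

lemma C_times_SucI:
  assumes "\<And>x. (f has_derivative f' x) (at x)" and "\<And>v. C_times k (\<lambda>x. f' x v)"
  shows "C_times (Suc k) f"
  using assms unfolding C_times_Suc_iff by blast

lemma C_times_SucD: "C_times (Suc k) f \<Longrightarrow> C_times k f"
proof (induction k arbitrary: f)
  case 0
  then show ?case
    by (auto simp: differentiable_on_def differentiable_at_withinI
        intro!: differentiable_imp_continuous_on)
qed auto

lemma C_times_const: "C_times k (\<lambda>x. c)"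
proof (induction k arbitrary: c)
  case (Suc k)
  show ?case by (rule C_times_SucI[where f' = "\<lambda>x v. 0"]) (auto simp: Suc)
qed simp

lemma C_times_bounded_linear_left:
  assumes "bounded_linear T" and "C_times k f"
  shows "C_times k (\<lambda>x. T (f x))"
  using assms(2)
proof (induction k arbitrary: f)
  case 0
  then show ?case
    by (auto intro!: continuous_on_compose2[OF linear_continuous_on[OF assms(1), of UNIV]])
next
  case (Suc k)
  then obtain f' where f': "\<And>x. (f has_derivative f' x) (at x)" "\<And>v. C_times k (\<lambda>x. f' x v)"
    unfolding C_times_Suc_iff by blast
  show ?case
    by (rule C_times_SucI[where f' = "\<lambda>x v. T (f' x v)"])
      (auto intro!: Suc.IH f' bounded_linear.has_derivative[OF assms(1)])
qed

lemma C_times_bounded_linear_right: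
  assumes "bounded_linear T" and "C_times k f"
  shows "C_times k (\<lambda>x. f (T x))"
  using assms(2)
proof (induction k arbitrary: f)
  case 0
  then show ?case
    by (auto intro!: continuous_on_compose2[of UNIV f] linear_continuous_on[OF assms(1)])
next
  case (Suc k)
  then obtain f' where f': "\<And>x. (f has_derivative f' x) (at x)" "\<And>v. C_times k (\<lambda>x. f' x v)"
    unfolding C_times_Suc_iff by blast
  show ?case
  proof (rule C_times_SucI[where f' = "\<lambda>x v. f' (T x) (T v)"])
    fix x
    show "((\<lambda>x. f (T x)) has_derivative (\<lambda>v. f' (T x) (T v))) (at x)"
      using diff_chain_at[OF bounded_linear_imp_has_derivative[OF assms(1)] f'(1)]
      by (simp add: o_def)
  qed (auto intro: Suc.IH f')
qed

lemma C_times_add: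
  assumes "C_times k f" and "C_times k g"
  shows "C_times k (\<lambda>x. f x + g x)"
  using assms
proof (induction k arbitrary: f g)
  case 0
  then show ?case by (auto intro: continuous_intros)
next
  case (Suc k)
  then obtain f' g' where
    f': "\<And>x. (f has_derivative f' x) (at x)" "\<And>v. C_times k (\<lambda>x. f' x v)" and
    g': "\<And>x. (g has_derivative g' x) (at x)" "\<And>v. C_times k (\<lambda>x. g' x v)"
    unfolding C_times_Suc_iff by blast
  show ?case
    by (rule C_times_SucI[where f' = "\<lambda>x v. f' x v + g' x v"])
      (auto intro!: Suc.IH f' g' has_derivative_add)
qed

lemma C_times_bilinear:
  assumes "bounded_bilinear p" and "C_times k f" and "C_times k g"
  shows "C_times k (\<lambda>x. p (f x) (g x))"
  using assms(2,3)
proof (induction k arbitrary: f g)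
  case 0
  then show ?case by (auto intro: bounded_bilinear.continuous_on[OF assms(1)])
next
  case (Suc k)
  then obtain f' g' where
    f': "\<And>x. (f has_derivative f' x) (at x)" "\<And>v. C_times k (\<lambda>x. f' x v)" and
    g': "\<And>x. (g has_derivative g' x) (at x)" "\<And>v. C_times k (\<lambda>x. g' x v)"
    unfolding C_times_Suc_iff by blast
  \<comment> \<open>The product rule leaves one factor undifferentiated, which must be known at the
    lower order as well.\<close>
  have "C_times k f" "C_times k g"
    using Suc.prems by (auto intro: C_times_SucD)
  then show ?case
    by (intro C_times_SucI[where f' = "\<lambda>x v. p (f x) (g' x v) + p (f' x v) (g x)"])
      (auto intro!: Suc.IH f' g' C_times_add bounded_bilinear.FDERIV[OF assms(1)])
qed

text \<open>\<open>G\<close> lists all iterated derivatives of the outer function. The chain rule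
  moves from \<open>G n\<close> to \<open>G (Suc n)\<close>, which is why the induction keeps
  \<open>n\<close> arbitrary.\<close>

lemma C_times_real_compose:
  assumes "\<And>n x. x \<in> S \<Longrightarrow> (G n has_real_derivative G (Suc n) x) (at x)"
    and "\<And>x. f x \<in> S" and "C_times k f"
  shows "C_times k (\<lambda>x. G n (f x))"
  using assms(3)
proof (induction k arbitrary: n)
  case 0
  have "continuous_on S (G n)"
    using assms(1) by (auto intro!: continuous_at_imp_continuous_on DERIV_isCont)
  with 0 show ?case
    using assms(2) by (auto intro: continuous_on_compose2[of S "G n"])
next
  case (Suc k)
  then obtain f' where f': "\<And>x. (f has_derivative f' x) (at x)" "\<And>v. C_times k (\<lambda>x. f' x v)"
    unfolding C_times_Suc_iff by blast
  have "C_times k (\<lambda>x. G (Suc n) (f x))"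
    by (intro Suc.IH C_times_SucD[OF Suc.prems])
  then show ?case
    using DERIV_compose_FDERIV[OF assms(1)[OF assms(2)] f'(1)]
    by (intro C_times_SucI[where f' = "\<lambda>x v. f' x v * G (Suc n) (f x)"])
      (auto intro!: C_times_bilinear[OF bounded_bilinear_mult] f')
qed

lemma smooth_const: "smooth (\<lambda>x. c)"
  by (simp add: smooth_def C_times_const)

lemma smooth_bounded_linear_left: "bounded_linear T \<Longrightarrow> smooth f \<Longrightarrow> smooth (\<lambda>x. T (f x))"
  by (simp add: smooth_def C_times_bounded_linear_left)

lemma smooth_bounded_linear_right: "bounded_linear T \<Longrightarrow> smooth f \<Longrightarrow> smooth (\<lambda>x. f (T x))"
  by (simp add: smooth_def C_times_bounded_linear_right)

lemma smooth_ident: "smooth (\<lambda>x. x)"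
  unfolding smooth_def
proof
  fix k show "C_times k (\<lambda>x::'a. x)"
    by (cases k) (auto intro!: C_times_const simp: frechet_derivative_at[OF has_derivative_ident, symmetric])
qed

lemma smooth_linear: "bounded_linear T \<Longrightarrow> smooth T"
  using smooth_bounded_linear_left[OF _ smooth_ident] .

lemma smooth_add: "smooth f \<Longrightarrow> smooth g \<Longrightarrow> smooth (\<lambda>x. f x + g x)"
  by (simp add: smooth_def C_times_add)

lemma smooth_bilinear:
  "bounded_bilinear p \<Longrightarrow> smooth f \<Longrightarrow> smooth g \<Longrightarrow> smooth (\<lambda>x. p (f x) (g x))"
  by (simp add: smooth_def C_times_bilinear)

lemmas smooth_mult = smooth_bilinear[OF bounded_bilinear_mult]
  and smooth_scaleR = smooth_bilinear[OF bounded_bilinear_scaleR]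
  and smooth_inner = smooth_bilinear[OF bounded_bilinear_inner]

lemma smooth_real_compose:
  assumes "\<And>n x. x \<in> S \<Longrightarrow> (G n has_real_derivative G (Suc n) x) (at x)"
    and "\<And>x. f x \<in> S" and "smooth f"
  shows "smooth (\<lambda>x. G n (f x))"
  using assms C_times_real_compose[of S G f] by (simp add: smooth_def)

lemma smooth_powr:
  fixes a :: real
  assumes "smooth f" and "\<And>x. f x > 0"
  shows "smooth (\<lambda>x. f x powr a)"
proof -
  \<comment> \<open>The iterated derivatives of a real power, with falling factorials as
    coefficients.\<close>
  let ?G = "\<lambda>n x. (\<Prod>i<n. a - real i) * x powr (a - real n)"
  have "(?G n has_real_derivative ?G (Suc n) x) (at x)" if "x \<in> {0<..}" for n x
    using that by (auto intro!: derivative_eq_intros simp: algebra_simps)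
  from smooth_real_compose[where S = "{0<..}" and G = ?G and n = 0 and f = f, OF this] assms
  show ?thesis by simp
qed

lemma smooth_has_derivative: "smooth f \<Longrightarrow> (f has_derivative frechet_derivative f (at x)) (at x)"
  unfolding smooth_def by (metis C_times.simps(2) frechet_derivative_works)

lemma smooth_frechet_derivative: "smooth f \<Longrightarrow> smooth (\<lambda>x. frechet_derivative f (at x) v)"
  unfolding smooth_def by (metis C_times.simps(2))

lemma smooth_continuous_on: "smooth f \<Longrightarrow> continuous_on S f"
  unfolding smooth_def by (metis C_times.simps(1) continuous_on_subset subset_UNIV)

text \<open>With z = 1/x one has d/dx = - z^2 d/dz, which sends p(z) exp(-z) to z^2 (p - p')(z)
  exp(-z).\<close>

fun bump_poly :: "nat \<Rightarrow> real poly" where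
  "bump_poly 0 = 1"
| "bump_poly (Suc n) = [:0, 0, 1:] * (bump_poly n - pderiv (bump_poly n))"

text \<open>The iterated derivatives of \<open>x \<mapsto> exp (-1/x)\<close>, extended by zero.\<close>

definition bump :: "nat \<Rightarrow> real \<Rightarrow> real" where
  "bump n x = (if x > 0 then poly (bump_poly n) (1 / x) * exp (- (1 / x)) else 0)"

lemma poly_times_exp_minus_tendsto_0: "((\<lambda>z::real. poly p z * exp (- z)) \<longlongrightarrow> 0) at_top"
proof -
  have "((\<lambda>z. \<Sum>i\<le>degree p. coeff p i * (z ^ i / exp z)) \<longlongrightarrow> (\<Sum>i\<le>degree p. coeff p i * 0)) at_top"
    by (intro tendsto_intros tendsto_power_div_exp_0)
  then show ?thesis
    by (simp add: poly_altdef sum_distrib_right exp_minus divide_inverse mult.assoc)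
qed

lemma bump_has_real_derivative: "(bump n has_real_derivative bump (Suc n) x) (at x)"
proof (cases "x = 0")
  case False
  show ?thesis
  proof (cases "x > 0")
    case True
    have "((\<lambda>x. poly (bump_poly n) (1 / x) * exp (- (1 / x))) has_real_derivative bump (Suc n) x) (at x)"
      using True
      by (auto intro!: derivative_eq_intros DERIV_chain'[where g = "poly _"] poly_DERIV
          simp: bump_def field_simps power2_eq_square)
    then show ?thesis
      by (rule has_field_derivative_transform_within_open[where S = "{0<..}"])
        (use True in \<open>auto simp: bump_def\<close>)
  next
    case neg: False
    have "((\<lambda>x. 0) has_real_derivative bump (Suc n) x) (at x)"
      using neg by (simp add: bump_def)
    then show ?thesis
      by (rule has_field_derivative_transform_within_open[where S = "{..<0}"])
        (use neg False in \<open>auto simp: bump_def\<close>)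
  qed
next
  case True
  have "((\<lambda>h. bump n h / h) \<longlongrightarrow> 0) (at 0)"
  proof (rule filterlim_split_at_real)
    show "((\<lambda>h. bump n h / h) \<longlongrightarrow> 0) (at_left 0)"
      by (rule tendsto_eventually)
        (auto simp: eventually_at_filter bump_def intro!: eventuallyI)
    \<comment> \<open>The extra factor \<open>[:0, 1:]\<close> is the 1/h of the difference
      quotient, absorbed into the polynomial in 1/h.\<close>
    have "((\<lambda>h::real. poly ([:0, 1:] * bump_poly n) (inverse h) * exp (- inverse h)) \<longlongrightarrow> 0) (at_right 0)"
      using poly_times_exp_minus_tendsto_0 filterlim_inverse_at_top_right by (rule filterlim_compose)
    then show "((\<lambda>h. bump n h / h) \<longlongrightarrow> 0) (at_right 0)"
      by (rule Lim_transform_eventually)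
        (auto simp: eventually_at_filter bump_def field_simps intro!: eventuallyI)
  qed
  with True show ?thesis
    by (simp add: DERIV_def bump_def)
qed

lemma smooth_bump: "smooth f \<Longrightarrow> smooth (\<lambda>x. bump n (f x))"
  using smooth_real_compose[where G = bump and S = UNIV] bump_has_real_derivative by blast

section \<open>The complex Hessian of the Eguchi-Hanson potential\<close>

definition cdot :: "complex^2 \<Rightarrow> complex^2 \<Rightarrow> complex" where
  "cdot X Y = X $ 1 * cnj (Y $ 1) + X $ 2 * cnj (Y $ 2)"

lemma cdot_simps [simp]:
  "cdot (X + X') Y = cdot X Y + cdot X' Y" "cdot X (Y + Y') = cdot X Y + cdot X Y'"
  "cdot (a *s X) Y = a * cdot X Y" "cdot X (a *s Y) = cnj a * cdot X Y"
  "cnj (cdot X Y) = cdot Y X"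
  by (simp_all add: cdot_def algebra_simps)

lemma Re_cdot: "Re (cdot X Y) = X \<bullet> Y"
  by (simp add: cdot_def inner_vec_def sum_2 inner_complex_def)

lemma bounded_linear_cdot_right: "bounded_linear (cdot Y)"
  unfolding cdot_def
  by (intro bounded_linear_add bounded_linear_const_mult
      bounded_linear_compose[OF bounded_linear_cnj bounded_linear_vec_nth])

lemmas has_derivative_cdot_right = bounded_linear.has_derivative[OF bounded_linear_cdot_right]

definition EH_u :: "hom_coords \<Rightarrow> real" where
  "EH_u p = cmod (snd p) * (fst p \<bullet> fst p)"

definition EH_q :: "real \<Rightarrow> hom_coords \<Rightarrow> real" where
  "EH_q t p = sqrt ((EH_u p)\<^sup>2 + t ^ 4)"

text \<open>Twice the logarithmic derivative of \<open>EH_u\<close> along \<open>(1,0)\<close>-vectors.\<close>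

definition EH_dlog :: "hom_coords \<Rightarrow> hom_coords \<Rightarrow> complex" where
  "EH_dlog p X = snd X / snd p + 2 * cdot (fst X) (fst p) / of_real (fst p \<bullet> fst p)"

lemma EH_dlog_J [simp]: "EH_dlog p (J X) = \<i> * EH_dlog p X"
  by (simp add: EH_dlog_def J_def algebra_simps)

lemma EH_potential_eq:
  "EH_potential t p = EH_q t p + t\<^sup>2 * ln (EH_u p / (EH_q t p + t\<^sup>2))"
proof -
  have csq: "(cmod (csqrt c))\<^sup>2 = cmod c" for c
    by (simp flip: norm_power)
  have "(cmod (zcoords p $ 1))\<^sup>2 + (cmod (zcoords p $ 2))\<^sup>2 = EH_u p"
    by (simp add: EH_u_def zcoords_def norm_mult power_mult_distrib csq inner_vec_def sum_2
        dot_square_norm distrib_left)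
  then show ?thesis
    by (simp add: EH_potential_def EH_q_def Let_def)
qed

lemma EH_u_has_derivative:
  assumes "snd p \<noteq> 0" and "fst p \<noteq> 0"
  shows "(EH_u has_derivative (\<lambda>X. EH_u p * Re (EH_dlog p X))) (at p)"
proof -
  have "(EH_u has_derivative (\<lambda>X. cmod (snd p) * (2 * (fst X \<bullet> fst p))
      + (snd X \<bullet> sgn (snd p)) * (fst p \<bullet> fst p))) (at p)"
    unfolding EH_u_def using assms(1)
      has_derivative_compose[OF has_derivative_snd[OF has_derivative_ident] has_derivative_norm[of "snd p"]]
    by (auto intro!: derivative_eq_intros simp: inner_commute fun_eq_iff)
  moreover have "cmod (snd p) * (2 * (fst X \<bullet> fst p)) + (snd X \<bullet> sgn (snd p)) * (fst p \<bullet> fst p)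
      = EH_u p * Re (EH_dlog p X)" for X
  proof -
    have "snd X \<bullet> sgn (snd p) = cmod (snd p) * Re (snd X / snd p)"
    proof -
      have "Re (snd X / snd p) = (snd X \<bullet> snd p) / (cmod (snd p))\<^sup>2"
        by (simp add: Re_divide cmod_power2 inner_complex_def)
      then show ?thesis
        using assms(1) by (simp add: sgn_div_norm power2_eq_square divide_inverse_commute)
    qed
    moreover have "fst p \<bullet> fst p \<noteq> 0"
      using assms(2) by simp
    ultimately show ?thesis
      by (simp add: EH_u_def EH_dlog_def Re_cdot[symmetric] Re_divide_of_real) (simp add: field_simps)
  qed
  ultimately show ?thesis by simp
qed

lemma EH_u_pos: "snd p \<noteq> 0 \<Longrightarrow> fst p \<noteq> 0 \<Longrightarrow> EH_u p > 0"
  by (simp add: EH_u_def)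

lemma EH_q_pos: "snd p \<noteq> 0 \<Longrightarrow> fst p \<noteq> 0 \<Longrightarrow> EH_q t p > 0"
  using EH_u_pos[of p] by (simp add: EH_q_def add_pos_nonneg)

lemma EH_q_has_derivative:
  assumes "snd p \<noteq> 0" and "fst p \<noteq> 0"
  shows "(EH_q t has_derivative (\<lambda>X. (EH_u p)\<^sup>2 / EH_q t p * Re (EH_dlog p X))) (at p)"
proof -
  have "(EH_u p)\<^sup>2 + t ^ 4 > 0"
    using EH_u_pos[OF assms] by (simp add: add_pos_nonneg)
  then have "((\<lambda>u. sqrt (u\<^sup>2 + t ^ 4)) has_real_derivative EH_u p / EH_q t p) (at (EH_u p))"
    by (auto intro!: derivative_eq_intros simp: EH_q_def field_simps)
  from DERIV_compose_FDERIV[OF this EH_u_has_derivative[OF assms]] show ?thesis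
    unfolding EH_q_def by (simp add: power2_eq_square mult_ac)
qed

text \<open>As a function of u the potential f satisfies u f'(u) = q: the logarithmic term is what
  turns the u^2 / q coming from the square root into q. What remains is q times d log u.\<close>

lemma EH_potential_has_derivative:
  assumes "snd p \<noteq> 0" and "fst p \<noteq> 0"
  shows "(EH_potential t has_derivative (\<lambda>X. EH_q t p * Re (EH_dlog p X))) (at p)"
proof -
  let ?u = "EH_u p" and ?q = "EH_q t p"
  have u: "?u > 0" and q: "?q > 0"
    using EH_u_pos EH_q_pos assms by auto
  have q2: "?q\<^sup>2 = ?u\<^sup>2 + t ^ 4"
    by (simp add: EH_q_def)
  have "?q + t\<^sup>2 > 0"
    using q by (simp add: add_pos_nonneg)
  with u have "((\<lambda>p. EH_q t p + t\<^sup>2 * (ln (EH_u p) - ln (EH_q t p + t\<^sup>2))) has_derivative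
      (\<lambda>X. (?u\<^sup>2 / ?q + t\<^sup>2 * (1 - ?u\<^sup>2 / (?q * (?q + t\<^sup>2)))) * Re (EH_dlog p X))) (at p)"
    by (auto intro!: derivative_eq_intros EH_u_has_derivative EH_q_has_derivative assms
        simp: fun_eq_iff field_simps)
  moreover have "?u\<^sup>2 / ?q + t\<^sup>2 * (1 - ?u\<^sup>2 / (?q * (?q + t\<^sup>2))) = ?q"
  proof -
    have "?u\<^sup>2 = (?q + t\<^sup>2) * (?q - t\<^sup>2)"
      using q2 by (simp add: algebra_simps power2_eq_square power4_eq_xxxx)
    then have "?u\<^sup>2 / (?q * (?q + t\<^sup>2)) = (?q - t\<^sup>2) / ?q"
      using \<open>?q + t\<^sup>2 > 0\<close> by simp
    then have "?u\<^sup>2 / ?q + t\<^sup>2 * (1 - ?u\<^sup>2 / (?q * (?q + t\<^sup>2))) = ?u\<^sup>2 / ?q + t\<^sup>2 * (1 - (?q - t\<^sup>2) / ?q)"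
      by (simp only:)
    also have "\<dots> = (?u\<^sup>2 + t ^ 4) / ?q"
      using q by (simp add: field_simps power2_eq_square power4_eq_xxxx)
    finally show ?thesis
      using q unfolding q2[symmetric] by (simp add: power2_eq_square)
  qed
  ultimately have "((\<lambda>p. EH_q t p + t\<^sup>2 * (ln (EH_u p) - ln (EH_q t p + t\<^sup>2))) has_derivative
      (\<lambda>X. ?q * Re (EH_dlog p X))) (at p)"
    by simp
  then show ?thesis
  proof (rule has_derivative_transform_within_open[where s = "{p. snd p \<noteq> 0 \<and> fst p \<noteq> 0}"])
    show "open {p::hom_coords. snd p \<noteq> 0 \<and> fst p \<noteq> 0}"
      by (intro open_Collect_conj open_Collect_neq continuous_intros)
    fix p :: hom_coords assume "p \<in> {p. snd p \<noteq> 0 \<and> fst p \<noteq> 0}"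
    then have "EH_u p > 0" "EH_q t p + t\<^sup>2 > 0"
      using EH_u_pos EH_q_pos by (auto simp: add_pos_nonneg)
    then show "EH_q t p + t\<^sup>2 * (ln (EH_u p) - ln (EH_q t p + t\<^sup>2)) = EH_potential t p"
      by (simp add: EH_potential_eq ln_div)
  qed (use assms in auto)
qed

text \<open>The matrix of second derivatives \<open>\<partial>\<partial>\<^sup>- f\<close>, written so that it makes sense
  on the zero section.\<close>

definition EH_hess :: "real \<Rightarrow> hom_coords \<Rightarrow> hom_coords \<Rightarrow> hom_coords \<Rightarrow> complex" where
  "EH_hess t p X Y =
     (let n = complex_of_real (fst p \<bullet> fst p); q = complex_of_real (EH_q t p);
          l = (\<lambda>X. snd X / 2 + snd p * cdot (fst X) (fst p) / n)
      in q * (cdot (fst X) (fst Y) / n - cdot (fst X) (fst p) * cdot (fst p) (fst Y) / n\<^sup>2)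
         + n\<^sup>2 / q * (l X * cnj (l Y)))"

lemma EH_hess_J:
  "EH_hess t p (J X) Y = \<i> * EH_hess t p X Y" "EH_hess t p X (J Y) = - \<i> * EH_hess t p X Y"
  by (simp_all add: EH_hess_def J_def Let_def algebra_simps add_divide_distrib diff_divide_distrib)

lemma EH_hess_cnj: "cnj (EH_hess t p X Y) = EH_hess t p Y X"
  by (simp add: EH_hess_def Let_def mult_ac)

lemma d_antihol_potential:
  assumes "snd p \<noteq> 0" and "fst p \<noteq> 0"
  shows "d_antihol Y (\<lambda>x. complex_of_real (EH_potential t x)) p
    = of_real (EH_q t p) * cnj (EH_dlog p Y) / 2"
proof -
  have "frechet_derivative (\<lambda>x. complex_of_real (EH_potential t x)) (at p)
      = (\<lambda>X. complex_of_real (EH_q t p * Re (EH_dlog p X)))"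
    using has_derivative_of_real[OF EH_potential_has_derivative[OF assms]]
    by (intro frechet_derivative_at[symmetric])
  then show ?thesis
    by (simp add: d_antihol_def complex_eq_iff)
qed

text \<open>Since u f'(u) = q, the Hessian splits into q times that of log u, which is the
  Fubini-Study form of the projective line, and u^2 / q times the product of the (1,0) and (0,1)
  parts of d log u.\<close>

lemma d_hol_d_antihol_potential:
  assumes "snd p \<noteq> 0" and "fst p \<noteq> 0"
  shows "d_hol X (d_antihol Y (\<lambda>x. complex_of_real (EH_potential t x))) p = EH_hess t p X Y"
proof -
  let ?F = "\<lambda>x. complex_of_real (EH_potential t x)"
  let ?n = "fst p \<bullet> fst p" and ?q = "complex_of_real (EH_q t p)"
  \<comment> \<open>\<open>W\<close> is the real derivative of the point-dependent quantity
    \<open>EH_dlog p Y\<close>, and \<open>D\<close> that of the whole product; the (1,0) part is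
    extracted only afterwards.\<close>
  define W where "W = (\<lambda>X. - (snd Y * snd X / (snd p)\<^sup>2) + 2 * cdot (fst Y) (fst X) / of_real ?n
      - 4 * cdot (fst Y) (fst p) * of_real (fst X \<bullet> fst p) / (of_real ?n)\<^sup>2)"
  define D where "D = (\<lambda>X. of_real ((EH_u p)\<^sup>2 / EH_q t p * Re (EH_dlog p X)) * (cnj (EH_dlog p Y) / 2)
      + ?q * (cnj (W X) / 2))"
  have n: "?n \<noteq> 0" and q: "?q \<noteq> 0"
    using assms EH_q_pos[OF assms, of t] by auto
  have "((\<lambda>p. EH_dlog p Y) has_derivative W) (at p)"
    unfolding EH_dlog_def W_def using assms n
    by (auto intro!: derivative_eq_intros has_derivative_cdot_right
        simp: fun_eq_iff field_simps power2_eq_square inner_commute)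
  then have "((\<lambda>p. of_real (EH_q t p) * (cnj (EH_dlog p Y) / 2)) has_derivative D) (at p)"
    unfolding D_def
    by (auto intro!: derivative_eq_intros EH_q_has_derivative assms simp: fun_eq_iff)
  then have "(d_antihol Y ?F has_derivative D) (at p)"
  proof (rule has_derivative_transform_within_open[where s = "{p. snd p \<noteq> 0 \<and> fst p \<noteq> 0}"])
    show "open {p::hom_coords. snd p \<noteq> 0 \<and> fst p \<noteq> 0}"
      by (intro open_Collect_conj open_Collect_neq continuous_intros)
  qed (use assms in \<open>auto simp: d_antihol_potential\<close>)
  then have "frechet_derivative (d_antihol Y ?F) (at p) = D"
    by (rule frechet_derivative_at[symmetric])
  then have "d_hol X (d_antihol Y ?F) p = (D X - \<i> * D (J X)) / 2"
    by (simp add: d_hol_def)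
  also have "\<dots> = of_real ((EH_u p)\<^sup>2 / EH_q t p) * (EH_dlog p X * cnj (EH_dlog p Y)) / 4
      + ?q * (cdot (fst X) (fst Y) / of_real ?n
              - cdot (fst X) (fst p) * cdot (fst p) (fst Y) / (of_real ?n)\<^sup>2)"
  proof -
    have 1: "of_real (Re (EH_dlog p X)) - \<i> * of_real (Re (EH_dlog p (J X))) = EH_dlog p X"
      by (simp add: complex_eq_iff)
    have "of_real (fst X \<bullet> fst p) - \<i> * of_real (fst (J X) \<bullet> fst p) = cdot (fst X) (fst p)"
      by (simp add: complex_eq_iff J_def flip: Re_cdot)
    then have 2: "\<i> * of_real (fst (J X) \<bullet> fst p) = of_real (fst X \<bullet> fst p) - cdot (fst X) (fst p)"
      by (simp add: algebra_simps)
    have "cnj (W X) - \<i> * cnj (W (J X)) = 4 * (cdot (fst X) (fst Y) / of_real ?n)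
        - 4 * cdot (fst p) (fst Y) * (of_real (fst X \<bullet> fst p) - \<i> * of_real (fst (J X) \<bullet> fst p))
           / (of_real ?n)\<^sup>2"
      by (simp add: W_def J_def algebra_simps diff_divide_distrib)
    then have 3: "cnj (W X) - \<i> * cnj (W (J X)) = 4 * (cdot (fst X) (fst Y) / of_real ?n)
        - 4 * cdot (fst p) (fst Y) * cdot (fst X) (fst p) / (of_real ?n)\<^sup>2"
      unfolding 2 by simp
    have "D X - \<i> * D (J X) = of_real ((EH_u p)\<^sup>2 / EH_q t p) * (cnj (EH_dlog p Y) / 2)
          * (of_real (Re (EH_dlog p X)) - \<i> * of_real (Re (EH_dlog p (J X))))
        + ?q / 2 * (cnj (W X) - \<i> * cnj (W (J X)))"
      by (simp add: D_def algebra_simps diff_divide_distrib add_divide_distrib)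
    from this[unfolded 1 3] show ?thesis
      by (simp only:) (simp add: algebra_simps add_divide_distrib diff_divide_distrib)
  qed
  also have "\<dots> = EH_hess t p X Y"
  proof -
    \<comment> \<open>The factor |c|^2 in u^2, where c is the fibre coordinate, cancels the two
      poles 1/c of \<open>EH_dlog\<close>; this produces the form of \<open>EH_hess\<close> that is
      regular on the zero section.\<close>
    have u2: "complex_of_real ((EH_u p)\<^sup>2) = snd p * cnj (snd p) * (of_real ?n)\<^sup>2"
      by (simp add: EH_u_def power_mult_distrib flip: complex_norm_square)
    have l: "snd Z / 2 + snd p * cdot (fst Z) (fst p) / of_real ?n = snd p * EH_dlog p Z / 2" for Z
      using assms n by (simp add: EH_dlog_def field_simps)
    show ?thesis
      unfolding EH_hess_def Let_def l of_real_divide u2 by simp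
  qed
  finally show ?thesis .
qed

text \<open>The Hessian h is Hermitian and conjugate linear in the second slot, so i (h(X, JY) -
  h(JY, X)) = h(X, Y) + h(Y, X).\<close>

lemma EH_form_J_eq:
  assumes "snd p \<noteq> 0" and "fst p \<noteq> 0"
  shows "EH_form t p X (J Y) = 2 * Re (EH_hess t p X Y)"
  using EH_hess_cnj[of t p X Y, symmetric]
  by (simp add: EH_form_def Let_def d_hol_d_antihol_potential[OF assms] EH_hess_J algebra_simps)

text \<open>On the zero section the metric is a limit from outside. There \<open>EH_hess\<close> is
  continuous because q is at least t^2 > 0, so the limit is its value.\<close>

lemma EH_metric_eq:
  assumes "t \<noteq> 0" and "fst p \<noteq> 0"
  shows "EH_metric t p X Y = 2 * Re (EH_hess t p X Y)"
proof (cases "snd p = 0")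
  case False
  then show ?thesis
    using EH_form_J_eq assms by (simp add: EH_metric_def)
next
  case True
  let ?S = "{x::hom_coords. snd x \<noteq> 0}"
  have "(EH_u p)\<^sup>2 + t ^ 4 > 0"
    using assms(1) by (intro add_nonneg_pos) auto
  then have "EH_q t p \<noteq> 0"
    by (simp add: EH_q_def)
  then have "isCont (\<lambda>p. EH_hess t p X Y) p"
    unfolding EH_hess_def Let_def EH_q_def EH_u_def cdot_def using assms
    by (intro continuous_intros) auto
  then have "isCont (\<lambda>p. 2 * Re (EH_hess t p X Y)) p"
    by (intro continuous_intros continuous_Re)
  then have "((\<lambda>p. 2 * Re (EH_hess t p X Y)) \<longlongrightarrow> 2 * Re (EH_hess t p X Y)) (at p within ?S)"
    by (auto simp: isCont_def intro: tendsto_within_subset)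
  moreover have "\<forall>\<^sub>F x in at p within ?S. fst x \<noteq> 0"
    using assms(2) by (intro tendsto_imp_eventually_ne[where c = "fst p"] tendsto_intros)
  then have "\<forall>\<^sub>F x in at p within ?S. 2 * Re (EH_hess t x X Y) = EH_form t x X (J Y)"
    by (auto simp: eventually_at_filter EH_form_J_eq elim: eventually_mono)
  ultimately have "((\<lambda>x. EH_form t x X (J Y)) \<longlongrightarrow> 2 * Re (EH_hess t p X Y)) (at p within ?S)"
    by (rule Lim_transform_eventually)
  \<comment> \<open>\<open>tendsto_Lim\<close> needs a nontrivial filter: points with a small
    nonzero fibre coordinate accumulate at \<open>p\<close>.\<close>
  moreover have "at p within ?S \<noteq> bot"
  proof -
    have "p islimpt ?S"
      unfolding islimpt_approachable
    proof (intro allI impI)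
      fix e :: real assume "e > 0"
      then have "(fst p, complex_of_real (e / 2)) \<noteq> p" "dist (fst p, complex_of_real (e / 2)) p < e"
        using True by (auto simp: prod_eq_iff dist_prod_def)
      then show "\<exists>x\<in>?S. x \<noteq> p \<and> dist x p < e"
        using \<open>e > 0\<close> by (intro bexI[of _ "(fst p, complex_of_real (e / 2))"]) auto
    qed
    then show ?thesis
      by (simp add: trivial_limit_within)
  qed
  ultimately show ?thesis
    using True by (simp add: EH_metric_def tendsto_Lim)
qed

text \<open>This is what removes \<open>A\<close> from the induced metric: the Hessian sees the
  first components only through Hermitian products.\<close>

lemma cdot_unitary:
  assumes "unitary A"
  shows "cdot (A *v x) (A *v y) = cdot x y"
proof -
  have "(\<chi> i j. cnj (A $ j $ i)) ** A = mat 1"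
    using assms by (simp add: unitary_def)
  then have U: "cnj (A $ 1 $ i) * A $ 1 $ j + cnj (A $ 2 $ i) * A $ 2 $ j = (if i = j then 1 else 0)" for i j
    by (auto simp: vec_eq_iff matrix_matrix_mult_def mat_def sum_2)
  have "cdot (A *v x) (A *v y) = (\<Sum>i\<in>UNIV. \<Sum>j\<in>UNIV. x $ j * cnj (y $ i) *
      (cnj (A $ 1 $ i) * A $ 1 $ j + cnj (A $ 2 $ i) * A $ 2 $ j))"
    by (simp add: cdot_def matrix_vector_mult_def sum_2 algebra_simps)
  also have "\<dots> = cdot x y"
    unfolding U by (simp add: cdot_def sum_2)
  finally show ?thesis .
qed

section \<open>Periodic functions, derivatives along vector fields, and two-component
  functions\<close>

lemma has_derivative_shift:
  fixes f :: "'a::real_normed_vector \<Rightarrow> 'b::real_normed_vector"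
  assumes "\<And>x. f (x + c) = f x" and "(f has_derivative f') (at (x + c))"
  shows "(f has_derivative f') (at x)"
proof -
  have "((\<lambda>x. f (x + c)) has_derivative (\<lambda>v. f' (v + 0))) (at x)"
    using assms(2)
    by (intro has_derivative_compose[where f = "\<lambda>x. x + c" and g = f] derivative_intros) auto
  then show ?thesis
    by (simp add: assms(1))
qed

lemma frechet_derivative_shift:
  assumes "\<And>x. f (x + c) = f x" and "smooth f"
  shows "frechet_derivative f (at (x + c)) = frechet_derivative f (at x)"
  using has_derivative_shift[of f c, OF assms(1) smooth_has_derivative[OF assms(2)]]
  by (rule frechet_derivative_at)

lemma smooth_has_derivative_real:
  fixes f :: "real \<Rightarrow> 'a::real_normed_vector"
  assumes "smooth f"
  shows "(f has_derivative (\<lambda>v. v *\<^sub>R frechet_derivative f (at s) 1)) (at s)"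
proof -
  note d = smooth_has_derivative[OF assms, of s]
  have "frechet_derivative f (at s) = (\<lambda>v. v *\<^sub>R frechet_derivative f (at s) 1)"
  proof
    fix v show "frechet_derivative f (at s) v = v *\<^sub>R frechet_derivative f (at s) 1"
      using linear_scale[OF has_derivative_linear[OF d], of v 1] by (simp only: real_scaleR_def mult_1_right)
  qed
  then show ?thesis
    using d by (simp only:)
qed

lemma smooth_Pair:
  assumes "smooth f" and "smooth g"
  shows "smooth (\<lambda>x. (f x, g x))"
proof -
  have "bounded_linear (\<lambda>y::'b. (y, 0::'c))" "bounded_linear (\<lambda>y::'c. (0::'b, y))"
    by (auto intro: bounded_linear_Pair bounded_linear_ident bounded_linear_zero)
  from smooth_add[OF smooth_bounded_linear_left[OF this(1) assms(1)]
      smooth_bounded_linear_left[OF this(2) assms(2)]]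
  show ?thesis by simp
qed

lemma smooth_sum: "(\<And>i. i \<in> I \<Longrightarrow> smooth (f i)) \<Longrightarrow> smooth (\<lambda>x. \<Sum>i\<in>I. f i x)"
  by (induction I rule: infinite_finite_induct) (auto intro: smooth_const smooth_add)

text \<open>Smoothness is known only for derivatives in fixed directions, so the moving direction is
  expanded in the standard basis.\<close>

lemma smooth_frechet_derivative_field:
  assumes "smooth f" and "smooth V"
  shows "smooth (\<lambda>x. frechet_derivative f (at x) (V x))"
proof -
  have "frechet_derivative f (at x) (V x) = (\<Sum>b\<in>Basis. (V x \<bullet> b) *\<^sub>R frechet_derivative f (at x) b)" for x
  proof -
    interpret linear "frechet_derivative f (at x)"
      using smooth_has_derivative[OF assms(1)] by (rule has_derivative_linear)
    have "frechet_derivative f (at x) (\<Sum>b\<in>Basis. (V x \<bullet> b) *\<^sub>R b)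
        = (\<Sum>b\<in>Basis. (V x \<bullet> b) *\<^sub>R frechet_derivative f (at x) b)"
      by (simp only: sum scale)
    then show ?thesis
      by (simp only: euclidean_representation)
  qed
  moreover have "smooth (\<lambda>x. \<Sum>b\<in>Basis. (V x \<bullet> b) *\<^sub>R frechet_derivative f (at x) b)"
    by (intro smooth_sum smooth_scaleR smooth_inner smooth_const assms smooth_frechet_derivative)
  ultimately show ?thesis by (simp only:)
qed

lemma frechet_derivative_eq_0:
  assumes "open S" and "x \<in> S" and "\<And>y. y \<in> S \<Longrightarrow> f y = 0"
  shows "frechet_derivative f (at x) = (\<lambda>v. 0)"
  using has_derivative_transform_within_open[OF has_derivative_const[of 0] assms(1,2), of f] assms(3)
  by (intro frechet_derivative_at[symmetric]) auto

lemma bounded_linear_vector2: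
  "bounded_linear (\<lambda>z::complex. vector [z, 0] :: complex^2)"
  "bounded_linear (\<lambda>z::complex. vector [0, z] :: complex^2)"
proof -
  have "linear (\<lambda>z::complex. vector [z, 0] :: complex^2)"
    "linear (\<lambda>z::complex. vector [0, z] :: complex^2)"
    by (rule linearI; simp add: vec_eq_iff forall_2)+
  then show "bounded_linear (\<lambda>z::complex. vector [z, 0] :: complex^2)"
    "bounded_linear (\<lambda>z::complex. vector [0, z] :: complex^2)"
    by (simp_all only: linear_conv_bounded_linear)
qed

lemma has_derivative_vector2:
  assumes "(a has_derivative a') (at x)" and "(b has_derivative b') (at x)"
  shows "((\<lambda>x. vector [a x, b x] :: complex^2) has_derivative (\<lambda>v. vector [a' v, b' v])) (at x)"
proof -
  have split: "vector [y, z] = (vector [y, 0] + vector [0, z] :: complex^2)" for y z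
    by (simp add: vec_eq_iff forall_2)
  show ?thesis
    by (subst (1 2) split)
      (intro has_derivative_add bounded_linear_vector2[THEN bounded_linear.has_derivative] assms)
qed

lemma smooth_matrix_vector_mult:
  assumes "smooth f"
  shows "smooth (\<lambda>x. (B :: complex^2^2) *v f x)"
proof -
  have "linear ((*v) B)"
    by (rule linearI) (simp_all add: vec_eq_iff matrix_vector_mult_def sum_2 algebra_simps)
  then have "bounded_linear ((*v) B)"
    by (simp only: linear_conv_bounded_linear)
  from smooth_bounded_linear_left[OF this assms] show ?thesis .
qed

section \<open>The cutoff function, positive exactly between 1 and Y\<close>

definition cutoff :: "real \<Rightarrow> real \<Rightarrow> real" where
  "cutoff Y y = bump 0 ((y - 1) * (Y - y))"

definition cutoff' :: "real \<Rightarrow> real \<Rightarrow> real" where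
  "cutoff' Y y = bump 1 ((y - 1) * (Y - y)) * (Y + 1 - 2 * y)"

definition cutoff'' :: "real \<Rightarrow> real \<Rightarrow> real" where
  "cutoff'' Y y = bump 2 ((y - 1) * (Y - y)) * (Y + 1 - 2 * y)\<^sup>2 - 2 * bump 1 ((y - 1) * (Y - y))"

lemma bump_cutoff_has_real_derivative:
  "((\<lambda>y. bump n ((y - 1) * (Y - y))) has_real_derivative
     bump (Suc n) ((y - 1) * (Y - y)) * (Y + 1 - 2 * y)) (at y)"
proof -
  have "((\<lambda>y. (y - 1) * (Y - y)) has_real_derivative Y + 1 - 2 * y) (at y)"
    by (auto intro!: derivative_eq_intros)
  from DERIV_chain'[OF this bump_has_real_derivative] show ?thesis .
qed

lemma cutoff_has_real_derivative:
  "(cutoff Y has_real_derivative cutoff' Y y) (at y)"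
  "(cutoff' Y has_real_derivative cutoff'' Y y) (at y)"
proof -
  show "(cutoff Y has_real_derivative cutoff' Y y) (at y)"
    using bump_cutoff_has_real_derivative[of 0] by (simp add: cutoff_def[abs_def] cutoff'_def)
  have "((\<lambda>y. Y + 1 - 2 * y) has_real_derivative - 2) (at y)"
    by (auto intro!: derivative_eq_intros)
  from DERIV_mult[OF bump_cutoff_has_real_derivative[of 1] this]
  show "(cutoff' Y has_real_derivative cutoff'' Y y) (at y)"
    by (simp add: cutoff'_def[abs_def] cutoff''_def power2_eq_square numeral_2_eq_2 mult.assoc)
qed

lemma continuous_on_cutoff:
  "continuous_on S (cutoff Y)" "continuous_on S (cutoff' Y)" "continuous_on S (cutoff'' Y)"
proof -
  have "continuous_on S (\<lambda>y. bump n ((y - 1) * (Y - y)))" for n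
    using bump_cutoff_has_real_derivative
    by (auto intro!: continuous_at_imp_continuous_on dest: DERIV_isCont)
  then show "continuous_on S (cutoff Y)" "continuous_on S (cutoff' Y)" "continuous_on S (cutoff'' Y)"
    unfolding cutoff_def[abs_def] cutoff'_def[abs_def] cutoff''_def[abs_def]
    by (auto intro!: continuous_on_mult continuous_on_diff continuous_on_power continuous_on_add
        continuous_on_const continuous_on_id)
qed

lemma cutoff_eq_0:
  assumes "y \<notin> {1..Y}" and "Y \<ge> 1"
  shows "cutoff Y y = 0" "cutoff' Y y = 0" "cutoff'' Y y = 0"
proof -
  have "(y - 1) * (Y - y) \<le> 0"
    using assms by (auto simp: mult_le_0_iff)
  then show "cutoff Y y = 0" "cutoff' Y y = 0" "cutoff'' Y y = 0"
    by (simp_all add: cutoff_def cutoff'_def cutoff''_def bump_def)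
qed

lemma cutoff_ge:
  assumes "2 \<le> y" and "y \<le> Y - 1"
  shows "cutoff Y y \<ge> exp (- 1)"
proof -
  have "1 * 1 \<le> (y - 1) * (Y - y)"
    using assms by (intro mult_mono) auto
  then show ?thesis
    by (simp add: cutoff_def bump_def)
qed

lemma cutoff_bound:
  assumes "Y \<ge> 1"
  obtains B where "B \<ge> 1" "\<And>y. \<bar>cutoff Y y\<bar> \<le> B \<and> \<bar>cutoff' Y y\<bar> \<le> B \<and> \<bar>cutoff'' Y y\<bar> \<le> B"
proof -
  have "bounded (f ` {1..Y})" if "continuous_on {1..Y} f" for f :: "real \<Rightarrow> real"
    using that by (auto intro: compact_imp_bounded compact_continuous_image)
  from this[OF continuous_on_cutoff(1)] this[OF continuous_on_cutoff(2)] this[OF continuous_on_cutoff(3)]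
  obtain B1 B2 B3 where B: "\<And>y. y \<in> {1..Y} \<Longrightarrow> \<bar>cutoff Y y\<bar> \<le> B1"
    "\<And>y. y \<in> {1..Y} \<Longrightarrow> \<bar>cutoff' Y y\<bar> \<le> B2" "\<And>y. y \<in> {1..Y} \<Longrightarrow> \<bar>cutoff'' Y y\<bar> \<le> B3"
    unfolding bounded_iff by (metis imageI real_norm_def)
  show ?thesis
  proof (rule that[of "max 1 (max B1 (max B2 B3))"])
    fix y
    show "\<bar>cutoff Y y\<bar> \<le> max 1 (max B1 (max B2 B3)) \<and> \<bar>cutoff' Y y\<bar> \<le> max 1 (max B1 (max B2 B3))
        \<and> \<bar>cutoff'' Y y\<bar> \<le> max 1 (max B1 (max B2 B3))"
    proof (cases "y \<in> {1..Y}")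
      case True
      then show ?thesis using B[OF True] by (simp add: le_max_iff_disj)
    qed (use cutoff_eq_0[of y Y] assms in simp)
  qed simp
qed

text \<open>One application of the Dirac operator divides the radial profiles by sqrt (2 q); this
  rule prepares the second application.\<close>

lemma has_real_derivative_divide_sqrt:
  assumes "(f has_real_derivative f') (at p)" and "p > 0"
  shows "((\<lambda>p. f p / sqrt (2 * p)) has_real_derivative
    f' / sqrt (2 * p) - f p / (2 * p * sqrt (2 * p))) (at p)"
proof -
  define S where "S = sqrt (2 * p)"
  have S: "S > 0" "S * S = 2 * p"
    using assms(2) by (simp_all add: S_def)
  have "((\<lambda>p. sqrt (2 * p)) has_real_derivative 1 / S) (at p)"
    using assms(2) by (auto intro!: derivative_eq_intros simp: S_def field_simps)
  from DERIV_divide[OF assms(1) this] S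
  have "((\<lambda>p. f p / sqrt (2 * p)) has_real_derivative (f' * S - f p * (1 / S)) / (S * S)) (at p)"
    by (simp add: S_def)
  moreover have "(f' * S - f p * (1 / S)) / (S * S) = f' / S - f p / (S * S * S)"
    using S(1) by (simp add: field_simps)
  ultimately show ?thesis
    by (simp only: S(2) S_def[symmetric])
qed

section \<open>Norms of two-component vectors and boxes in the chart\<close>

lemma norm_vector2_le: "norm (vector [a, b] :: complex^2) \<le> cmod a + cmod b"
  using L2_set_le_sum[of UNIV "\<lambda>i. norm ((vector [a, b] :: complex^2) $ i)"]
  by (simp add: norm_vec_def sum_2)

lemma Basis_real_times_complex: "(Basis :: chart set) = {(1, 0), (0, 1), (0, \<i>)}"
  by (auto simp: Basis_prod_def Basis_complex_def)

lemma emeasure_chart_box: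
  assumes "a \<le> b" and "c \<le> d" and "c' \<le> d'"
  shows "emeasure lborel (cbox (a, Complex c c') (b, Complex d d')) = ennreal ((b - a) * (d - c) * (d' - c'))"
    and "emeasure lborel (box (a, Complex c c') (b, Complex d d')) = ennreal ((b - a) * (d - c) * (d' - c'))"
  using assms
  by (simp_all add: emeasure_lborel_cbox_eq emeasure_lborel_box_eq Basis_real_times_complex
      inner_complex_def mult_ac)

lemma chart_box_iff:
  fixes x :: chart
  shows "x \<in> cbox (a, Complex c c') (b, Complex d d') \<longleftrightarrow>
     fst x \<in> {a..b} \<and> Re (snd x) \<in> {c..d} \<and> Im (snd x) \<in> {c'..d'}"
    "x \<in> box (a, Complex c c') (b, Complex d d') \<longleftrightarrow>
     fst x \<in> {a<..<b} \<and> Re (snd x) \<in> {c<..<d} \<and> Im (snd x) \<in> {c'<..<d'}"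
  by (auto simp: mem_box Basis_real_times_complex inner_complex_def inner_prod_def)

section \<open>The hypersurface over a closed curve\<close>

locale EH_curve =
  fixes \<Gamma> :: "real \<Rightarrow> complex" and L t :: real and A :: "complex^2^2"
  assumes closed_curve: "closed_curve \<Gamma> L" and t: "t \<noteq> 0" and unitary: "unitary A"
begin

definition \<Gamma>' :: "real \<Rightarrow> complex" where "\<Gamma>' s = frechet_derivative \<Gamma> (at s) 1"

lemma smooth_\<Gamma>: "smooth \<Gamma>" and L_pos: "L > 0" and \<Gamma>_periodic: "\<Gamma> (s + L) = \<Gamma> s"
  using closed_curve by (auto simp: closed_curve_def)

lemma smooth_\<Gamma>': "smooth \<Gamma>'"
  unfolding \<Gamma>'_def by (rule smooth_frechet_derivative[OF smooth_\<Gamma>])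

lemma \<Gamma>'_periodic: "\<Gamma>' (s + L) = \<Gamma>' s"
  by (simp add: \<Gamma>'_def frechet_derivative_shift[OF \<Gamma>_periodic smooth_\<Gamma>])

lemma \<Gamma>_has_derivative: "(\<Gamma> has_derivative (\<lambda>v. v *\<^sub>R \<Gamma>' s)) (at s)"
  unfolding \<Gamma>'_def by (rule smooth_has_derivative_real[OF smooth_\<Gamma>])

lemma norm_\<Gamma>': "cmod (\<Gamma>' s) = 1"
proof -
  have "vector_derivative \<Gamma> (at s) = \<Gamma>' s"
    using \<Gamma>_has_derivative[of s]
    by (intro vector_derivative_at) (simp add: has_vector_derivative_def)
  then show ?thesis
    using closed_curve unfolding closed_curve_def by metis
qed

definition N :: "chart \<Rightarrow> real" where "N x = \<Gamma> (fst x) \<bullet> \<Gamma> (fst x) + 1"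

text \<open>The coefficient of the orthogonal projection of the derivative of the lift (\<Gamma>, 1)
  onto the lift itself. It enters \<eta> with the factor 2 because rescaling the lift by a
  multiplies the fibre coordinate by a^2.\<close>

definition \<mu> :: "chart \<Rightarrow> complex" where
  "\<mu> x = \<Gamma>' (fst x) * cnj (\<Gamma> (fst x)) / of_real (N x)"

definition q :: "chart \<Rightarrow> real" where
  "q x = sqrt ((N x)\<^sup>2 * (snd x \<bullet> snd x) + t ^ 4)"

definition \<Lambda> :: "chart \<Rightarrow> real" where "\<Lambda> x = sqrt (2 * q x) / N x"

text \<open>The vertical part of a tangent vector with respect to the connection whose horizontal
  distribution is orthogonal to the fibres.\<close>

definition \<eta> :: "chart \<Rightarrow> chart \<Rightarrow> complex" where
  "\<eta> x X = snd X + 2 * \<mu> x * snd x * of_real (fst X)"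

lemma N_ge_1: "N x \<ge> 1"
  by (simp add: N_def)

lemma N_pos: "N x > 0" and N_neq_0: "N x \<noteq> 0"
  using N_ge_1[of x] by auto

lemma q_radicand_pos: "(N x)\<^sup>2 * (snd x \<bullet> snd x) + t ^ 4 > 0"
  using t by (intro add_nonneg_pos) auto

lemma q_sq: "(q x)\<^sup>2 = (N x)\<^sup>2 * (snd x \<bullet> snd x) + t ^ 4"
  using q_radicand_pos[of x] by (simp add: q_def)

lemma q_pos: "q x > 0" and \<Lambda>_pos: "\<Lambda> x > 0"
  using q_radicand_pos[of x] N_pos[of x] by (auto simp: q_def \<Lambda>_def)

lemma \<Lambda>_sq: "(\<Lambda> x)\<^sup>2 = 2 * q x / (N x)\<^sup>2"
  using q_pos[of x] by (simp add: \<Lambda>_def power_divide)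

definition g :: metric where "g = induced_metric t A \<Gamma>"

lemma lift_param_has_derivative:
  "(lift_param A \<Gamma> has_derivative (\<lambda>X. (A *v vector [fst X *\<^sub>R \<Gamma>' (fst x), 0], snd X))) (at x)"
proof -
  let ?T = "\<lambda>z. A *v vector [z, 0]"
  have "linear ?T"
    by (rule linearI)
      (simp_all add: vec_eq_iff matrix_vector_mult_def sum_2 algebra_simps)
  then have T: "bounded_linear ?T"
    by (simp add: linear_conv_bounded_linear)
  have eq: "lift_param A \<Gamma> = (\<lambda>x. (?T (\<Gamma> (fst x)) + A *v vector [0, 1], snd x))"
    by (auto simp: lift_param_def fun_eq_iff vec_eq_iff matrix_vector_mult_def sum_2)
  show ?thesis
    unfolding eq
    by (auto intro!: derivative_eq_intros bounded_linear.has_derivative[OF T]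
        has_derivative_compose[OF _ \<Gamma>_has_derivative, of fst fst])
qed

text \<open>By unitary invariance the Hessian is evaluated at the lift (\<Gamma>, 1). As |\<Gamma>'|
  = 1 and |\<Gamma>|^2 = N - 1, its Fubini-Study part gives 1/N - (N - 1)/N^2 = 1/N^2, hence the
  coefficient 2 q / N^2 of ds^2. The linear form inside \<open>EH_hess\<close> becomes \<eta> / 2,
  which yields the fibre term.\<close>

lemma g_eq: "g x X Y = (\<Lambda> x)\<^sup>2 * fst X * fst Y + (\<eta> x X \<bullet> \<eta> x Y) / (\<Lambda> x)\<^sup>2"
proof -
  let ?v = "vector [\<Gamma> (fst x), 1] :: complex^2"
  let ?N = "complex_of_real (N x)" and ?G = "\<Gamma> (fst x)" and ?G' = "\<Gamma>' (fst x)"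
  define p where "p = lift_param A \<Gamma> x"
  have n: "fst p \<bullet> fst p = N x"
    by (simp add: p_def lift_param_def cdot_unitary[OF unitary] flip: Re_cdot)
      (simp add: cdot_def N_def inner_complex_def)
  have "EH_u p = cmod (snd x) * N x"
    by (simp add: EH_u_def n) (simp add: p_def lift_param_def)
  then have EH_q: "EH_q t p = q x"
    by (simp add: EH_q_def q_def power_mult_distrib dot_square_norm mult.commute)
  have "g x X Y = 2 * Re (EH_hess t p (A *v vector [fst X *\<^sub>R ?G', 0], snd X)
      (A *v vector [fst Y *\<^sub>R ?G', 0], snd Y))"
    unfolding g_def induced_metric_def Let_def p_def
      frechet_derivative_at[OF lift_param_has_derivative, symmetric]
    by (rule EH_metric_eq[OF t fst_lift_param_neq_0[OF unitary]])
  also have "EH_hess t p (A *v vector [fst X *\<^sub>R ?G', 0], snd X)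
      (A *v vector [fst Y *\<^sub>R ?G', 0], snd Y)
    = of_real (q x) * (of_real (fst X * fst Y) * (?G' * cnj ?G') / ?N
        - of_real (fst X * fst Y) * (?G' * cnj ?G') * (?G * cnj ?G) / ?N\<^sup>2)
      + ?N\<^sup>2 / of_real (q x) * (\<eta> x X / 2 * cnj (\<eta> x Y / 2))"
  proof -
    have c: "cdot (A *v vector [a *\<^sub>R ?G', 0]) (fst p) = of_real a * (?G' * cnj ?G)"
      "cdot (fst p) (A *v vector [a *\<^sub>R ?G', 0]) = of_real a * (?G * cnj ?G')"
      "cdot (A *v vector [a *\<^sub>R ?G', 0]) (A *v vector [b *\<^sub>R ?G', 0])
        = of_real (a * b) * (?G' * cnj ?G')" for a b
      by (simp_all add: p_def lift_param_def cdot_unitary[OF unitary])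
        (simp_all add: cdot_def scaleR_conv_of_real)
    have l: "snd Z / 2 + snd p * (of_real (fst Z) * (?G' * cnj ?G)) / ?N = \<eta> x Z / 2" for Z
      by (simp add: \<eta>_def \<mu>_def p_def lift_param_def add_divide_distrib mult_ac)
    show ?thesis
      unfolding EH_hess_def Let_def n EH_q fst_conv snd_conv c l by (simp add: mult_ac)
  qed
  also have "?G' * cnj ?G' = 1"
    by (simp add: norm_\<Gamma>' flip: complex_norm_square)
  also have "?G * cnj ?G = ?N - 1"
    by (simp add: N_def dot_square_norm flip: complex_norm_square)
  also have "2 * Re (of_real (q x) * (of_real (fst X * fst Y) * 1 / ?N
        - of_real (fst X * fst Y) * 1 * (?N - 1) / ?N\<^sup>2)
      + ?N\<^sup>2 / of_real (q x) * (\<eta> x X / 2 * cnj (\<eta> x Y / 2)))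
    = 2 * (q x * (fst X * fst Y * 1 / N x - fst X * fst Y * 1 * (N x - 1) / (N x)\<^sup>2)
      + (N x)\<^sup>2 / q x * (\<eta> x X \<bullet> \<eta> x Y) / 4)"
  proof -
    have "of_real (q x) * (of_real (fst X * fst Y) * 1 / ?N
        - of_real (fst X * fst Y) * 1 * (?N - 1) / ?N\<^sup>2)
      + ?N\<^sup>2 / of_real (q x) * (\<eta> x X / 2 * cnj (\<eta> x Y / 2))
      = of_real (q x * (fst X * fst Y * 1 / N x - fst X * fst Y * 1 * (N x - 1) / (N x)\<^sup>2))
        + of_real ((N x)\<^sup>2 / q x / 4) * (\<eta> x X * cnj (\<eta> x Y))"
      by simp
    then show ?thesis
      by (simp add: inner_complex_def)
  qed
  also have "\<dots> = (\<Lambda> x)\<^sup>2 * fst X * fst Y + (\<eta> x X \<bullet> \<eta> x Y) / (\<Lambda> x)\<^sup>2"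
    unfolding \<Lambda>_sq using N_pos[of x] q_pos[of x] by (simp add: field_simps power2_eq_square)
  finally show ?thesis .
qed

section \<open>The Dirac operator in the frame\<close>

definition E :: "3 \<Rightarrow> vfield" where
  "E i x = vector [(0, of_real (\<Lambda> x)), (0, of_real (\<Lambda> x) * \<i>),
     (1 / \<Lambda> x, - 2 * \<mu> x * snd x / of_real (\<Lambda> x))] $ i"

lemma g_E: "g x Z (E 1 x) = Re (\<eta> x Z) / \<Lambda> x" "g x Z (E 2 x) = Im (\<eta> x Z) / \<Lambda> x"
  "g x Z (E 3 x) = \<Lambda> x * fst Z"
  using \<Lambda>_pos[of x]
  by (simp_all add: g_eq E_def \<eta>_def inner_complex_def power2_eq_square)

lemma frame_eq: "frame g i x = E i x"
proof -
  note l = \<Lambda>_pos[of x]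
  have 1: "normalize_vec g x (coord_vec 1) = E 1 x"
    using l by (simp add: normalize_vec_def coord_vec_def g_eq \<eta>_def E_def real_sqrt_divide scaleR_conv_of_real)
  have 2: "normalize_vec g x (coord_vec 2 - g x (coord_vec 2) (E 1 x) *\<^sub>R E 1 x) = E 2 x"
    using l unfolding g_E
    by (simp add: normalize_vec_def coord_vec_def g_eq \<eta>_def E_def real_sqrt_divide scaleR_conv_of_real)
  have v: "coord_vec 3 - g x (coord_vec 3) (E 1 x) *\<^sub>R E 1 x - g x (coord_vec 3) (E 2 x) *\<^sub>R E 2 x
      = (1, - 2 * \<mu> x * snd x)"
    using l unfolding g_E
    by (simp add: coord_vec_def \<eta>_def E_def prod_eq_iff complex_eq_iff)
  have 3: "normalize_vec g x (1, - 2 * \<mu> x * snd x) = E 3 x"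
    using l by (simp add: normalize_vec_def g_eq \<eta>_def E_def real_sqrt_mult scaleR_conv_of_real divide_inverse)
  show ?thesis
    unfolding frame_def Let_def 1 2 v 3 using exhaust_3[of i] by auto
qed

lemma frame_eq': "frame g = E"
  by (simp add: fun_eq_iff frame_eq)

lemma g_E_E: "g x (E i x) (E j x) = (if i = j then 1 else 0)"
  using exhaust_3[of i] exhaust_3[of j] \<Lambda>_pos[of x]
  by (auto simp: g_E) (auto simp: E_def \<eta>_def)

text \<open>\<eta> is dw plus a multiple of ds, so passing to it does not change the determinant,
  which is \<Lambda>^2 times the square of \<Lambda>^(-2).\<close>

lemma volume_density: "sqrt (det (\<chi> i j. g x (coord_vec i) (coord_vec j))) = 1 / \<Lambda> x"
proof -
  have "det (\<chi> i j. g x (coord_vec i) (coord_vec j)) = (1 / \<Lambda> x)\<^sup>2"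
    using \<Lambda>_pos[of x]
    by (simp add: det_3 g_eq coord_vec_def \<eta>_def inner_complex_def field_simps power2_eq_square)
  then show ?thesis
    using \<Lambda>_pos[of x] by (simp add: real_sqrt_divide power_divide)
qed

lemma N_has_derivative: "(N has_derivative (\<lambda>X. 2 * N x * Re (\<mu> x) * fst X)) (at x)"
proof -
  have "(N has_derivative (\<lambda>X. \<Gamma> (fst x) \<bullet> (fst X *\<^sub>R \<Gamma>' (fst x)) + (fst X *\<^sub>R \<Gamma>' (fst x)) \<bullet> \<Gamma> (fst x))) (at x)"
    unfolding N_def
    by (auto intro!: derivative_eq_intros has_derivative_compose[OF _ \<Gamma>_has_derivative, of fst fst])
  moreover have "N x * Re (\<mu> x) = \<Gamma>' (fst x) \<bullet> \<Gamma> (fst x)"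
    using N_pos[of x] by (simp add: \<mu>_def inner_complex_def)
  ultimately show ?thesis
    by (simp add: inner_commute mult.assoc mult.left_commute[of _ "fst _"] mult.commute[of _ "fst _"])
qed

text \<open>The derivative of N along the curve supplies just the term that completes dw to \<eta>.
  Hence dq depends on \<eta> only, and \<open>E 3\<close>, on which \<eta> vanishes, annihilates
  q.\<close>

lemma q_has_derivative:
  "(q has_derivative (\<lambda>X. (N x)\<^sup>2 / q x * (snd x \<bullet> \<eta> x X))) (at x)"
proof -
  let ?r = "\<lambda>x. (N x)\<^sup>2 * (snd x \<bullet> snd x) + t ^ 4"
  have "(?r has_derivative (\<lambda>X. 2 * (N x)\<^sup>2 * (snd x \<bullet> \<eta> x X))) (at x)"
    by (auto intro!: derivative_eq_intros N_has_derivative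
        simp: fun_eq_iff \<eta>_def inner_complex_def power2_eq_square algebra_simps)
  from DERIV_compose_FDERIV[OF DERIV_real_sqrt[OF q_radicand_pos[of x]] this]
  show ?thesis
    unfolding q_def by (simp add: field_simps)
qed

definition d\<Lambda> :: "chart \<Rightarrow> chart \<Rightarrow> real" where
  "d\<Lambda> x X = \<Lambda> x * ((N x)\<^sup>2 / (2 * (q x)\<^sup>2) * (snd x \<bullet> \<eta> x X) - 2 * Re (\<mu> x) * fst X)"

lemma \<Lambda>_has_derivative: "(\<Lambda> has_derivative d\<Lambda> x) (at x)"
proof -
  have "((\<lambda>q. sqrt (2 * q)) has_real_derivative sqrt (2 * q x) / (2 * q x)) (at (q x))"
    using q_pos[of x]
    by (auto intro!: derivative_eq_intros simp: field_simps)
  from has_derivative_divide[OF DERIV_compose_FDERIV[OF this q_has_derivative] N_has_derivative N_neq_0]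
  show ?thesis
    unfolding \<Lambda>_def[abs_def] d\<Lambda>_def
    by (rule has_derivative_eq_rhs) (use N_pos[of x] q_pos[of x] in
        \<open>simp add: fun_eq_iff field_simps power2_eq_square\<close>)
qed

definition \<mu>' :: "real \<Rightarrow> complex" where
  "\<mu>' s = vector_derivative (\<lambda>s. \<Gamma>' s * cnj (\<Gamma> s) / of_real (\<Gamma> s \<bullet> \<Gamma> s + 1)) (at s)"

lemma \<mu>_has_derivative: "(\<mu> has_derivative (\<lambda>X. fst X *\<^sub>R \<mu>' (fst x))) (at x)"
proof -
  have "\<Gamma> s \<bullet> \<Gamma> s + 1 \<noteq> 0" for s
    using inner_ge_zero[of "\<Gamma> s"] by linarith
  then have nz: "complex_of_real (\<Gamma> s \<bullet> \<Gamma> s + 1) \<noteq> 0" for s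
    by (simp only: of_real_eq_0_iff not_False_eq_True)
  have "(\<lambda>s. \<Gamma>' s * cnj (\<Gamma> s) / of_real (\<Gamma> s \<bullet> \<Gamma> s + 1)) differentiable at s" for s
    using has_derivative_divide'[OF has_derivative_mult[OF smooth_has_derivative_real[OF smooth_\<Gamma>']
          has_derivative_cnj[OF \<Gamma>_has_derivative]] has_derivative_of_real[OF has_derivative_add[OF
            has_derivative_inner[OF \<Gamma>_has_derivative \<Gamma>_has_derivative] has_derivative_const]] nz]
    by (rule differentiableI)
  then have "((\<lambda>s. \<Gamma>' s * cnj (\<Gamma> s) / of_real (\<Gamma> s \<bullet> \<Gamma> s + 1)) has_derivative
      (\<lambda>v. v *\<^sub>R \<mu>' s)) (at s)" for s
    unfolding \<mu>'_def by (simp add: vector_derivative_works flip: has_vector_derivative_def)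
  from has_derivative_compose[OF has_derivative_fst[OF has_derivative_ident] this]
  show ?thesis by (simp add: \<mu>_def[abs_def] N_def)
qed

lemma E_has_derivative:
  "(E 1 has_derivative (\<lambda>X. (0, of_real (d\<Lambda> x X)))) (at x)"
  "(E 2 has_derivative (\<lambda>X. (0, of_real (d\<Lambda> x X) * \<i>))) (at x)"
  "(E 3 has_derivative (\<lambda>X. (- d\<Lambda> x X / (\<Lambda> x)\<^sup>2,
     2 * \<mu> x * snd x * of_real (d\<Lambda> x X) / of_real ((\<Lambda> x)\<^sup>2)
      - 2 * (\<mu> x * snd X + of_real (fst X) * \<mu>' (fst x) * snd x) / of_real (\<Lambda> x)))) (at x)"
  using \<Lambda>_pos[of x] unfolding E_def
  by (auto intro!: derivative_eq_intros \<Lambda>_has_derivative \<mu>_has_derivative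
      simp: fun_eq_iff field_simps power2_eq_square scaleR_conv_of_real)

definition bracket_coeff :: "3 \<Rightarrow> 3 \<Rightarrow> 3 \<Rightarrow> chart \<Rightarrow> real" where
  "bracket_coeff i j k x = g x (lie_bracket (E i) (E j) x) (E k x)"

text \<open>The inner products of an orthonormal frame are constant, so only the bracket terms of
  the Koszul formula survive.\<close>

lemma levi_civita_E:
  "levi_civita g (E i) (E j) (E k) x =
     (bracket_coeff i j k x - bracket_coeff j k i x + bracket_coeff k i j x) / 2"
  by (simp add: levi_civita_def g_E_E bracket_coeff_def)

lemma bracket_coeff_anti: "bracket_coeff j i k x = - bracket_coeff i j k x"
proof -
  have "lie_bracket (E j) (E i) x = - lie_bracket (E i) (E j) x"
    by (simp add: lie_bracket_def)
  then show ?thesis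
    using exhaust_3[of k] by (auto simp: bracket_coeff_def g_E \<eta>_def divide_simps)
qed

text \<open>Differentiating the factors \<Lambda> and 1 / \<Lambda> gives the four values with
  \<open>d\<Lambda>\<close>; they cancel in the divergences, for instance \<open>1 2 2\<close>
  against \<open>1 3 3\<close>. In brackets with \<open>E 3\<close> the derivative of \<Lambda>
  along the curve cancels the real part of \<mu>, leaving a rotation of the fibre with speed
  proportional to Im \<mu>.\<close>

lemma bracket_coeff_eqs:
  "bracket_coeff 1 2 1 x = - d\<Lambda> x (0, \<i>)" "bracket_coeff 1 2 2 x = d\<Lambda> x (0, 1)"
  "bracket_coeff 1 2 3 x = 0"
  "bracket_coeff 1 3 1 x = 0" "bracket_coeff 1 3 2 x = - 2 * Im (\<mu> x) / \<Lambda> x"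
  "bracket_coeff 1 3 3 x = - d\<Lambda> x (0, 1)"
  "bracket_coeff 2 3 1 x = 2 * Im (\<mu> x) / \<Lambda> x" "bracket_coeff 2 3 2 x = 0"
  "bracket_coeff 2 3 3 x = - d\<Lambda> x (0, \<i>)"
proof -
  note dE = E_has_derivative[THEN frechet_derivative_at, symmetric]
  have l: "d\<Lambda> x (E 1 x) = \<Lambda> x * d\<Lambda> x (0, 1)" "d\<Lambda> x (E 2 x) = \<Lambda> x * d\<Lambda> x (0, \<i>)"
    "d\<Lambda> x (E 3 x) = - 2 * Re (\<mu> x)"
    using \<Lambda>_pos[of x] by (auto simp: d\<Lambda>_def E_def \<eta>_def inner_complex_def)
  show "bracket_coeff 1 2 1 x = - d\<Lambda> x (0, \<i>)" "bracket_coeff 1 2 2 x = d\<Lambda> x (0, 1)"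
    "bracket_coeff 1 2 3 x = 0"
    using \<Lambda>_pos[of x] by (simp_all add: bracket_coeff_def g_E lie_bracket_def dE l \<eta>_def)
  show "bracket_coeff 1 3 1 x = 0" "bracket_coeff 1 3 2 x = - 2 * Im (\<mu> x) / \<Lambda> x"
    "bracket_coeff 1 3 3 x = - d\<Lambda> x (0, 1)" "bracket_coeff 2 3 1 x = 2 * Im (\<mu> x) / \<Lambda> x"
    "bracket_coeff 2 3 2 x = 0" "bracket_coeff 2 3 3 x = - d\<Lambda> x (0, \<i>)"
    using \<Lambda>_pos[of x] unfolding bracket_coeff_def g_E lie_bracket_def dE l \<eta>_def
    by (simp_all add: E_def power2_eq_square field_simps)
qed

lemma bracket_coeff_eqs':
  "bracket_coeff i i k x = 0"
  "bracket_coeff 2 1 k x = - bracket_coeff 1 2 k x"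
  "bracket_coeff 3 1 k x = - bracket_coeff 1 3 k x"
  "bracket_coeff 3 2 k x = - bracket_coeff 2 3 k x"
  using bracket_coeff_anti[of i i k x]
  by (simp_all add: bracket_coeff_anti[of 2 1] bracket_coeff_anti[of 3 1] bracket_coeff_anti[of 3 2])

text \<open>All divergences of the frame vanish, so that only the totally antisymmetric part of the
  connection contributes to the potential term.\<close>

lemma dirac_eq:
  "dirac g \<psi> x = (\<Sum>i\<in>UNIV. clifford i *v frechet_derivative \<psi> (at x) (E i x))
     + (Im (\<mu> x) / \<Lambda> x) *\<^sub>R \<psi> x"
proof -
  have "(\<Sum>i\<in>UNIV. clifford i *v ((1/4) *\<^sub>R (\<Sum>j\<in>UNIV. \<Sum>k\<in>UNIV. levi_civita g (E i) (E j) (E k) x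
      *\<^sub>R (clifford j *v (clifford k *v \<psi> x))))) = (Im (\<mu> x) / \<Lambda> x) *\<^sub>R \<psi> x"
    \<comment> \<open>The cyclic sum of the coefficients \<open>1 2 3\<close>, \<open>2 3 1\<close>,
      \<open>3 1 2\<close> is 4 Im \<mu> / \<Lambda>. The product of the three Clifford matrices is
      the identity, so the factor 1/4 leaves the scalar Im \<mu> / \<Lambda>.\<close>
    unfolding levi_civita_E
    by (simp add: sum_3 bracket_coeff_eqs bracket_coeff_eqs' clifford_def vec_eq_iff forall_2
        matrix_vector_mult_def sum_2)
      (simp add: scaleR_conv_of_real field_simps)
  then show ?thesis
    unfolding dirac_def spin_deriv_def frame_eq'
    by (simp add: matrix_vector_right_distrib sum.distrib)
qed

section \<open>Smoothness and periodicity of the coefficients, invariance of the test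
  spinors\<close>

lemmas smooth_snd = smooth_linear[OF bounded_linear_snd]

lemma smooth_N: "smooth N"
  unfolding N_def[abs_def]
  by (intro smooth_add smooth_inner smooth_const smooth_bounded_linear_right[OF bounded_linear_fst smooth_\<Gamma>])

lemma smooth_q: "smooth q"
proof -
  have "q = (\<lambda>x. (N x * N x * (snd x \<bullet> snd x) + t ^ 4) powr (1 / 2))"
    using q_radicand_pos by (auto simp: q_def fun_eq_iff powr_half_sqrt less_imp_le power2_eq_square)
  moreover have "smooth (\<lambda>x. (N x * N x * (snd x \<bullet> snd x) + t ^ 4) powr (1 / 2))"
    using q_radicand_pos
    by (intro smooth_powr smooth_add smooth_mult smooth_inner smooth_const smooth_N smooth_snd)
      (simp add: power2_eq_square)
  ultimately show ?thesis by (simp only:)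
qed

lemma smooth_\<Lambda>: "smooth \<Lambda>"
proof -
  have "\<Lambda> = (\<lambda>x. (2 * q x) powr (1 / 2) * N x powr - 1)"
    using q_pos N_pos
    by (auto simp: \<Lambda>_def fun_eq_iff powr_half_sqrt less_imp_le powr_minus_divide)
  moreover have "smooth (\<lambda>x. (2 * q x) powr (1 / 2) * N x powr - 1)"
    using q_pos N_pos by (intro smooth_powr smooth_mult smooth_const smooth_N smooth_q) auto
  ultimately show ?thesis by (simp only:)
qed

lemma smooth_inverse_\<Lambda>: "smooth (\<lambda>x. inverse (\<Lambda> x))"
  using smooth_powr[OF smooth_\<Lambda> \<Lambda>_pos, of "-1"] by (simp add: powr_minus \<Lambda>_pos less_imp_le)

lemma smooth_\<mu>: "smooth \<mu>"
proof -
  have "\<mu> = (\<lambda>x. (N x powr - 1) *\<^sub>R (\<Gamma>' (fst x) * cnj (\<Gamma> (fst x))))"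
    using N_pos by (auto simp: \<mu>_def fun_eq_iff powr_minus_divide less_imp_le scaleR_conv_of_real)
  moreover have "smooth (\<lambda>x. (N x powr - 1) *\<^sub>R (\<Gamma>' (fst x) * cnj (\<Gamma> (fst x))))"
    by (intro smooth_scaleR smooth_powr smooth_N N_pos smooth_mult
        smooth_bounded_linear_left[OF bounded_linear_cnj]
        smooth_bounded_linear_right[OF bounded_linear_fst] smooth_\<Gamma> smooth_\<Gamma>')
  ultimately show ?thesis by (simp only:)
qed

lemma smooth_E: "smooth (E i)"
proof -
  have "E 1 = (\<lambda>x. (0, of_real (\<Lambda> x)))" "E 2 = (\<lambda>x. (0, of_real (\<Lambda> x) * \<i>))"
    "E 3 = (\<lambda>x. (inverse (\<Lambda> x), inverse (\<Lambda> x) *\<^sub>R (- 2 * \<mu> x * snd x)))"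
    by (simp_all add: E_def fun_eq_iff divide_inverse scaleR_conv_of_real)
  moreover have "smooth (\<lambda>x. (0::real, complex_of_real (\<Lambda> x)))"
    "smooth (\<lambda>x. (0::real, complex_of_real (\<Lambda> x) * \<i>))"
    "smooth (\<lambda>x. (inverse (\<Lambda> x), inverse (\<Lambda> x) *\<^sub>R (- 2 * \<mu> x * snd x)))"
    by (intro smooth_Pair smooth_mult smooth_const smooth_scaleR smooth_inverse_\<Lambda> smooth_\<mu> smooth_snd
        smooth_bounded_linear_left[OF bounded_linear_of_real] smooth_\<Lambda>)+
  ultimately show ?thesis
    using exhaust_3[of i] by auto
qed

lemma coefficients_periodic:
  "N (x + (L, 0)) = N x" "\<mu> (x + (L, 0)) = \<mu> x" "q (x + (L, 0)) = q x" "\<Lambda> (x + (L, 0)) = \<Lambda> x"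
  "E i (x + (L, 0)) = E i x"
proof -
  show N: "N (x + (L, 0)) = N x" and \<mu>: "\<mu> (x + (L, 0)) = \<mu> x"
    by (simp_all add: N_def \<mu>_def \<Gamma>_periodic \<Gamma>'_periodic)
  show "q (x + (L, 0)) = q x" and \<Lambda>: "\<Lambda> (x + (L, 0)) = \<Lambda> x"
    by (simp_all add: q_def \<Lambda>_def N)
  show "E i (x + (L, 0)) = E i x"
    by (simp add: E_def \<mu> \<Lambda>)
qed

lemma smooth_dirac: "smooth \<psi> \<Longrightarrow> smooth (dirac g \<psi>)"
  unfolding dirac_eq[abs_def] divide_inverse
  by (intro smooth_add smooth_sum smooth_matrix_vector_mult smooth_frechet_derivative_field
      smooth_E smooth_scaleR smooth_mult smooth_inverse_\<Lambda>
      smooth_bounded_linear_left[OF bounded_linear_Im] smooth_\<mu>)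

text \<open>Makes the operator iterable on test spinors: \<psi> lies in the domain of the square,
  with \<open>dirac g \<psi>\<close> as intermediate element. Periodicity uses that the coefficients
  have period \<open>L\<close>, the support condition that the operator is local.\<close>

lemma test_spinor_dirac:
  assumes "test_spinor L \<psi>"
  shows "test_spinor L (dirac g \<psi>)"
proof -
  have sm: "smooth \<psi>" and per: "\<psi> (x + (L, 0)) = \<psi> x" for x
    using assms by (auto simp: test_spinor_def plus_prod_def)
  obtain R where R: "\<psi> (s, w) = 0" if "cmod w > R" for s w
    using assms by (auto simp: test_spinor_def)
  have "dirac g \<psi> (x + (L, 0)) = dirac g \<psi> x" for x
    by (simp add: dirac_eq coefficients_periodic per frechet_derivative_shift[OF per sm])
  then have "dirac g \<psi> (s + L, w) = dirac g \<psi> (s, w)" for s w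
    by (metis add.right_neutral add_Pair)
  moreover have "dirac g \<psi> (s, w) = 0" if "cmod w > R" for s w
  proof -
    have "open {x::chart. cmod (snd x) > R}"
      by (intro open_Collect_less continuous_intros)
    then have "frechet_derivative \<psi> (at (s, w)) = (\<lambda>v. 0)"
      using that R by (intro frechet_derivative_eq_0) auto
    then show ?thesis
      using R[OF that] by (simp add: dirac_eq)
  qed
  ultimately show ?thesis
    using smooth_dirac[OF sm] unfolding test_spinor_def by blast
qed

section \<open>The Dirac operator and its square on radial spinors\<close>

lemma dirac_vector:
  assumes "(a has_derivative a') (at x)" and "(b has_derivative b') (at x)"
  shows "dirac g (\<lambda>x. vector [a x, b x]) x =
    vector [\<i> * b' (E 1 x) + b' (E 2 x) + \<i> * a' (E 3 x) + of_real (Im (\<mu> x) / \<Lambda> x) * a x,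
            \<i> * a' (E 1 x) - a' (E 2 x) - \<i> * b' (E 3 x) + of_real (Im (\<mu> x) / \<Lambda> x) * b x]"
  unfolding dirac_eq frechet_derivative_at[OF has_derivative_vector2[OF assms], symmetric]
  by (simp add: sum_3 clifford_def vec_eq_iff forall_2 matrix_vector_mult_def sum_2)
    (simp add: scaleR_conv_of_real)

lemma compose_q_has_derivative:
  assumes "(f has_real_derivative f') (at (q x))"
  shows "((\<lambda>x. f (q x)) has_derivative (\<lambda>X. (N x)\<^sup>2 / q x * (snd x \<bullet> \<eta> x X) * f')) (at x)"
  by (rule DERIV_compose_FDERIV[OF assms q_has_derivative])

lemma E_components:
  "fst (E 1 x) = 0" "fst (E 2 x) = 0" "fst (E 3 x) = 1 / \<Lambda> x"
  "snd (E 1 x) = of_real (\<Lambda> x)" "snd (E 2 x) = of_real (\<Lambda> x) * \<i>"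
  "snd (E 3 x) = - 2 * \<mu> x * snd x / of_real (\<Lambda> x)"
  "\<eta> x (E 1 x) = of_real (\<Lambda> x)" "\<eta> x (E 2 x) = of_real (\<Lambda> x) * \<i>" "\<eta> x (E 3 x) = 0"
  using \<Lambda>_pos[of x] by (simp_all add: E_def \<eta>_def)

definition M :: "real \<Rightarrow> real" where "M s = Im (\<Gamma>' s * cnj (\<Gamma> s))"

definition M' :: "real \<Rightarrow> real" where "M' s = frechet_derivative M (at s) 1"

lemma Im_\<mu>: "Im (\<mu> x) = M (fst x) / N x"
  by (simp add: \<mu>_def M_def)

lemma smooth_M: "smooth M"
  unfolding M_def[abs_def]
  by (intro smooth_bounded_linear_left[OF bounded_linear_Im] smooth_mult smooth_\<Gamma>'
      smooth_bounded_linear_left[OF bounded_linear_cnj] smooth_\<Gamma>)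

lemma M_has_derivative: "((\<lambda>x. M (fst x)) has_derivative (\<lambda>X. fst X * M' (fst x))) (at x)"
  using has_derivative_compose[OF has_derivative_fst[OF has_derivative_ident]
      smooth_has_derivative_real[OF smooth_M]]
  by (simp add: M'_def)

text \<open>\<open>E 3\<close> annihilates q, and the N in 1 / \<Lambda> cancels the one in Im \<mu>
  = M / N. The result is a function of s times a profile in q, and N w times another profile; this
  is the shape treated by \<open>dirac_dirac_radial\<close>.\<close>

lemma dirac_radial:
  assumes "(f has_real_derivative f') (at (q x))"
  shows "dirac g (\<lambda>x. vector [of_real (f (q x)), 0]) x =
    vector [of_real (M (fst x) * (f (q x) / sqrt (2 * q x))),
            2 * \<i> * of_real (N x * (f' / sqrt (2 * q x))) * snd x]"
proof -
  have sq: "sqrt (2 * q x) * sqrt (2 * q x) = 2 * q x"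
    using q_pos[of x] by simp
  have D: "dirac g (\<lambda>x. vector [of_real (f (q x)), 0]) x =
    vector [of_real (Im (\<mu> x) / \<Lambda> x * f (q x)),
       \<i> * of_real ((N x)\<^sup>2 / q x * \<Lambda> x * f') * snd x]"
    by (subst dirac_vector[OF has_derivative_of_real[OF compose_q_has_derivative[OF assms]]
          has_derivative_const])
      (simp add: E_components vec_eq_iff forall_2 complex_eq_iff inner_complex_def algebra_simps)
  have c1: "Im (\<mu> x) / \<Lambda> x * f (q x) = M (fst x) * (f (q x) / sqrt (2 * q x))"
    using N_pos[of x] by (simp add: Im_\<mu> \<Lambda>_def)
  have c2: "(N x)\<^sup>2 / q x * \<Lambda> x * f' = 2 * (N x * (f' / sqrt (2 * q x)))"
    using N_pos[of x] q_pos[of x] sq by (simp add: \<Lambda>_def field_simps power2_eq_square)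
  show ?thesis
    unfolding D c1 c2 by (simp add: mult_ac)
qed

text \<open>Along \<open>E 3\<close> the growth of N compensates the real part of the motion of w,
  so N w is only rotated and Im \<mu> alone enters the second component. In the first one,
  \<open>E 1\<close> and \<open>E 2\<close> act on h(q) w like a divergence: 2 h from
  differentiating w, and h' weighted with |w|^2. M' arises from \<open>E 3\<close> acting on
  M.\<close>

lemma dirac_dirac_radial:
  assumes k: "(k has_real_derivative k') (at (q x))" and h: "(h has_real_derivative h') (at (q x))"
  shows "dirac g (\<lambda>x. vector [of_real (M (fst x) * k (q x)),
      2 * \<i> * of_real (N x * h (q x)) * snd x]) x =
    vector [\<i> * of_real (M' (fst x) * k (q x) / \<Lambda> x)
        + of_real ((M (fst x))\<^sup>2 * k (q x) / sqrt (2 * q x))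
        - 2 * of_real (sqrt (2 * q x) * (2 * h (q x) + h' * ((N x)\<^sup>2 * (snd x \<bullet> snd x) / q x))),
      \<i> * of_real (N x * (M (fst x) * k' * sqrt (2 * q x) / q x
        - 2 * M (fst x) * h (q x) / sqrt (2 * q x))) * snd x]"
proof -
  let ?a' = "\<lambda>X. complex_of_real (M (fst x) * ((N x)\<^sup>2 / q x * (snd x \<bullet> \<eta> x X) * k')
      + fst X * M' (fst x) * k (q x))"
  let ?b' = "\<lambda>X. 2 * \<i> * of_real (N x * h (q x)) * snd X
      + 2 * \<i> * of_real (N x * ((N x)\<^sup>2 / q x * (snd x \<bullet> \<eta> x X) * h')
      + 2 * N x * Re (\<mu> x) * fst X * h (q x)) * snd x"
  have a': "((\<lambda>x. of_real (M (fst x) * k (q x))) has_derivative ?a') (at x)"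
    by (intro has_derivative_of_real has_derivative_mult M_has_derivative compose_q_has_derivative k)
  have b': "((\<lambda>x. 2 * \<i> * of_real (N x * h (q x)) * snd x) has_derivative ?b') (at x)"
    by (intro has_derivative_mult has_derivative_mult_right has_derivative_of_real N_has_derivative
        compose_q_has_derivative h has_derivative_snd has_derivative_ident)
  have \<Lambda>: "of_real (\<Lambda> x) = complex_of_real (sqrt (2 * q x)) / of_real (N x)"
    by (simp add: \<Lambda>_def)
  have 1: "\<i> * ?b' (E 1 x) + ?b' (E 2 x) + \<i> * ?a' (E 3 x) + of_real (Im (\<mu> x) / \<Lambda> x) * of_real (M (fst x) * k (q x))
    = \<i> * of_real (M' (fst x) * k (q x) / \<Lambda> x)
        + of_real ((M (fst x))\<^sup>2 * k (q x) / sqrt (2 * q x))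
        - 2 * of_real (sqrt (2 * q x) * (2 * h (q x) + h' * ((N x)\<^sup>2 * (snd x \<bullet> snd x) / q x)))"
    using N_pos[of x] q_pos[of x]
    by (simp add: E_components Im_\<mu> \<Lambda>_def inner_complex_def complex_eq_iff power2_eq_square field_simps)
  have 2: "\<i> * ?a' (E 1 x) - ?a' (E 2 x) - \<i> * ?b' (E 3 x)
      + of_real (Im (\<mu> x) / \<Lambda> x) * (2 * \<i> * of_real (N x * h (q x)) * snd x)
    = \<i> * of_real (N x * (M (fst x) * k' * sqrt (2 * q x) / q x
        - 2 * M (fst x) * h (q x) / sqrt (2 * q x))) * snd x"
    using N_pos[of x] q_pos[of x]
    by (simp add: E_components Im_\<mu> \<Lambda>_def inner_complex_def complex_eq_iff power2_eq_square field_simps)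
  show ?thesis
    by (subst dirac_vector[OF a' b']) (simp only: 1 2)
qed

section \<open>The radial cutoff spinors and pointwise bounds for them\<close>

definition radial_spinor :: "real \<Rightarrow> real \<Rightarrow> spinor" where
  "radial_spinor Y R x = vector [of_real (cutoff Y (q x / R)), 0]"

lemma q_ge: "N x * cmod (snd x) \<le> q x" "cmod (snd x) \<le> q x"
proof -
  have "(N x * cmod (snd x))\<^sup>2 \<le> (q x)\<^sup>2"
    unfolding q_sq power_mult_distrib power2_norm_eq_inner by simp
  then show 1: "N x * cmod (snd x) \<le> q x"
    by (rule power2_le_imp_le) (simp add: less_imp_le[OF q_pos])
  show "cmod (snd x) \<le> q x"
    using 1 mult_right_mono[OF N_ge_1[of x] norm_ge_zero[of "snd x"]] by simp
qed

lemma test_spinor_radial_spinor: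
  assumes "R > 0" and "Y \<ge> 1"
  shows "test_spinor L (radial_spinor Y R)"
proof -
  have "smooth (\<lambda>x. cutoff Y (inverse R * q x))"
  proof -
    have "smooth (\<lambda>x. bump 0 ((inverse R * q x + - 1) * (Y + (- inverse R) * q x)))"
      by (intro smooth_bump smooth_mult smooth_add smooth_const smooth_q)
    then show ?thesis by (simp add: cutoff_def)
  qed
  then have "smooth (radial_spinor Y R)"
    unfolding radial_spinor_def[abs_def] divide_inverse mult.commute[of _ "inverse R"]
    by (intro smooth_bounded_linear_left[OF bounded_linear_vector2(1)]
        smooth_bounded_linear_left[OF bounded_linear_of_real])
  moreover have "radial_spinor Y R (s + L, w) = radial_spinor Y R (s, w)" for s w
    using coefficients_periodic(3)[of "(s, w)"] by (simp add: radial_spinor_def)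
  moreover have "radial_spinor Y R (s, w) = 0" if "cmod w > R * Y" for s w
  proof -
    have "q (s, w) / R > Y"
      using that q_ge(2)[of "(s, w)"] assms(1) by (simp add: pos_less_divide_eq mult.commute)
    then show ?thesis
      using cutoff_eq_0(1)[of "q (s, w) / R" Y] assms(2) by (simp add: radial_spinor_def vec_eq_iff forall_2)
  qed
  ultimately show ?thesis
    unfolding test_spinor_def by blast
qed

lemma dirac_dirac_radial_spinor:
  fixes Y R x
  assumes "R > 0"
  defines "y \<equiv> q x / R" and "S \<equiv> sqrt (2 * q x)"
  shows "dirac g (dirac g (radial_spinor Y R)) x =
    vector [\<i> * of_real (M' (fst x) * (cutoff Y y / S) / \<Lambda> x)
        + of_real ((M (fst x))\<^sup>2 * (cutoff Y y / S) / S)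
        - 2 * of_real (S * (2 * (cutoff' Y y / R / S)
            + (cutoff'' Y y / R\<^sup>2 / S - cutoff' Y y / R / (2 * q x * S))
              * ((N x)\<^sup>2 * (snd x \<bullet> snd x) / q x))),
      \<i> * of_real (N x * (M (fst x) * (cutoff' Y y / R / S - cutoff Y y / (2 * q x * S)) * S / q x
        - 2 * M (fst x) * (cutoff' Y y / R / S) / S)) * snd x]"
proof -
  have c: "((\<lambda>p. cutoff Y (p / R)) has_real_derivative cutoff' Y (p / R) / R) (at p)"
    "((\<lambda>p. cutoff' Y (p / R)) has_real_derivative cutoff'' Y (p / R) / R) (at p)" for p
    using DERIV_chain'[OF DERIV_cdivide[OF DERIV_ident] cutoff_has_real_derivative(1)]
      DERIV_chain'[OF DERIV_cdivide[OF DERIV_ident] cutoff_has_real_derivative(2)]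
    by simp_all
  have D: "dirac g (radial_spinor Y R) = (\<lambda>x. vector [of_real (M (fst x) * (cutoff Y (q x / R) / sqrt (2 * q x))),
            2 * \<i> * of_real (N x * (cutoff' Y (q x / R) / R / sqrt (2 * q x))) * snd x])"
    unfolding radial_spinor_def[abs_def]
    by (rule ext) (rule dirac_radial[where f = "\<lambda>p. cutoff Y (p / R)", OF c(1)])
  note k = has_real_derivative_divide_sqrt[OF c(1) q_pos[of x]]
  have "((\<lambda>p. cutoff' Y (p / R) / R) has_real_derivative cutoff'' Y y / R\<^sup>2) (at (q x))"
    using DERIV_cdivide[OF c(2)] by (simp add: y_def power2_eq_square)
  note h = has_real_derivative_divide_sqrt[OF this q_pos[of x]]
  from dirac_dirac_radial[OF k h] show ?thesis
    by (simp only: D y_def S_def)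
qed

text \<open>All three functions depend on s alone, so compactness of one period bounds them on
  entire fibres.\<close>

lemma bound_on_period:
  obtains B where "B \<ge> 1"
    "\<And>x. fst x \<in> {0..<L} \<Longrightarrow> N x \<le> B \<and> \<bar>M (fst x)\<bar> \<le> B \<and> \<bar>M' (fst x)\<bar> \<le> B"
proof -
  have "continuous_on {0..L} (N \<circ> (\<lambda>s. (s, 0)))"
    by (intro continuous_on_compose smooth_continuous_on smooth_N continuous_intros)
  then have "continuous_on {0..L} (\<lambda>s. N (s, 0))" "continuous_on {0..L} M" "continuous_on {0..L} M'"
    unfolding M'_def[abs_def] o_def
    by (auto intro!: smooth_continuous_on smooth_M smooth_frechet_derivative)
  then have "bounded ((\<lambda>s. N (s, 0)) ` {0..L})" "bounded (M ` {0..L})" "bounded (M' ` {0..L})"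
    by (auto intro: compact_imp_bounded compact_continuous_image)
  then obtain B1 B2 B3 where B: "\<And>s. s \<in> {0..L} \<Longrightarrow> \<bar>N (s, 0)\<bar> \<le> B1"
    "\<And>s. s \<in> {0..L} \<Longrightarrow> \<bar>M s\<bar> \<le> B2" "\<And>s. s \<in> {0..L} \<Longrightarrow> \<bar>M' s\<bar> \<le> B3"
    unfolding bounded_iff by (metis imageI real_norm_def)
  show ?thesis
  proof (rule that[of "max 1 (max B1 (max B2 B3))"])
    fix x :: chart assume "fst x \<in> {0..<L}"
    moreover have "N x = N (fst x, 0)"
      by (simp add: N_def)
    ultimately show "N x \<le> max 1 (max B1 (max B2 B3)) \<and> \<bar>M (fst x)\<bar> \<le> max 1 (max B1 (max B2 B3))
        \<and> \<bar>M' (fst x)\<bar> \<le> max 1 (max B1 (max B2 B3))"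
      using B(1)[of "fst x"] B(2,3)[of "fst x"] by (simp add: le_max_iff_disj abs_of_pos[OF N_pos])
  qed simp
qed

lemma dirac_dirac_radial_spinor_eq_0:
  assumes "R > 0" and "Y \<ge> 1" and "q x / R \<notin> {1..Y}"
  shows "dirac g (dirac g (radial_spinor Y R)) x = 0"
  by (simp add: dirac_dirac_radial_spinor[OF assms(1)] cutoff_eq_0[OF assms(3,2)] vec_eq_iff forall_2)

text \<open>On the support R \<le> q \<le> Y R. Two divisions by S = sqrt (2 q) give 1 / (2 q),
  which is at most 1/R, and N |w| \<le> q controls all factors w. The summands of the constant
  belong to the terms with M' and M^2 (\<open>B ^ 3\<close> each), to the purely radial term, and to
  the second component (\<open>B\<^sup>2\<close>).\<close>

lemma norm_dirac_dirac_radial_spinor_le: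
  assumes "R \<ge> 1" and "Y \<ge> 1" and "B \<ge> 0"
    and B: "N x \<le> B" "\<bar>M (fst x)\<bar> \<le> B" "\<bar>M' (fst x)\<bar> \<le> B"
      "\<And>y. \<bar>cutoff Y y\<bar> \<le> B" "\<And>y. \<bar>cutoff' Y y\<bar> \<le> B" "\<And>y. \<bar>cutoff'' Y y\<bar> \<le> B"
  shows "norm (dirac g (dirac g (radial_spinor Y R)) x) \<le> (2 * B ^ 3 + 2 * (3 * B + B * Y) + B\<^sup>2) / R"
proof (cases "q x / R \<in> {1..Y}")
  case False
  then show ?thesis
    using dirac_dirac_radial_spinor_eq_0[of R Y x] assms(1-3) by simp
next
  case True
  define c0 c1 c2 where "c0 = cutoff Y (q x / R)" and "c1 = cutoff' Y (q x / R)"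
    and "c2 = cutoff'' Y (q x / R)"
  define m m' S V where "m = M (fst x)" and "m' = M' (fst x)" and "S = sqrt (2 * q x)"
    and "V = N x * cmod (snd x)"
  have R: "R > 0" and q: "q x > 0" "R \<le> q x" "q x \<le> Y * R" and N: "N x > 0"
    using True assms(1) q_pos[of x] N_pos[of x] by (auto simp: field_simps)
  have S: "S > 0" "S * S = 2 * q x"
    using q by (simp_all add: S_def)
  have V: "0 \<le> V" "V \<le> q x" "(N x)\<^sup>2 * (snd x \<bullet> snd x) = V\<^sup>2"
    using N q_ge(1)[of x] by (simp_all add: V_def power_mult_distrib power2_norm_eq_inner)
  have c: "\<bar>c0\<bar> \<le> B" "\<bar>c1\<bar> \<le> B" "\<bar>c2\<bar> \<le> B" and m: "\<bar>m\<bar> \<le> B" "\<bar>m'\<bar> \<le> B"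
    using B by (simp_all add: c0_def c1_def c2_def m_def m'_def)
  have bound: "\<bar>a / b\<bar> \<le> a' / R" if "\<bar>a\<bar> \<le> a'" "R \<le> b" for a a' b
    using that R by (simp add: abs_divide frac_le)
  have "\<bar>m' * (c0 / S) / \<Lambda> x\<bar> \<le> B ^ 3 / R"
  proof -
    have "m' * (c0 / S) / \<Lambda> x = m' * c0 * N x / (S * S)"
      using N S(1) by (simp add: \<Lambda>_def flip: S_def)
    also have "\<bar>\<dots>\<bar> \<le> B * B * B / R"
      unfolding S(2) using q N c m B(1) assms(3)
      by (intro bound) (auto simp: abs_mult intro!: mult_mono)
    finally show ?thesis by (simp add: power3_eq_cube)
  qed
  moreover have "\<bar>m\<^sup>2 * (c0 / S) / S\<bar> \<le> B ^ 3 / R"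
  proof -
    have "m\<^sup>2 * (c0 / S) / S = m * m * c0 / (S * S)"
      by (simp add: power2_eq_square)
    also have "\<bar>\<dots>\<bar> \<le> B * B * B / R"
      unfolding S(2)
    proof (rule bound)
      show "\<bar>m * m * c0\<bar> \<le> B * B * B"
        unfolding abs_mult using c m assms(3)
        by (intro mult_mono mult_nonneg_nonneg abs_ge_zero) simp_all
    qed (use q in simp)
    finally show ?thesis by (simp add: power3_eq_cube)
  qed
  moreover have "\<bar>S * (2 * (c1 / R / S) + (c2 / R\<^sup>2 / S - c1 / R / (2 * q x * S)) * (V\<^sup>2 / q x))\<bar>
      \<le> (3 * B + B * Y) / R"
  proof -
    have "V\<^sup>2 \<le> (q x)\<^sup>2"
      using V by (simp add: power_mono)
    then have Vq: "0 \<le> V\<^sup>2 / q x" "V\<^sup>2 / q x \<le> q x"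
      using q by (simp_all add: pos_divide_le_eq power2_eq_square)
    \<comment> \<open>The second derivative comes with 1 / R^2 but is multiplied by V^2 / q \<le> q
      \<le> Y R, which leaves Y / R.\<close>
    have e: "S * (2 * (c1 / R / S) + (c2 / R\<^sup>2 / S - c1 / R / (2 * q x * S)) * (V\<^sup>2 / q x))
      = 2 * c1 / R + c2 * (V\<^sup>2 / q x / R) / R - c1 * (V\<^sup>2 / q x / (2 * q x)) / R"
      using S(1) R q by (simp add: field_simps power2_eq_square)
    have b1: "\<bar>2 * c1 / R\<bar> \<le> 2 * B / R"
      using c by (intro bound) auto
    have "V\<^sup>2 / q x / R \<le> Y"
      using divide_right_mono[OF order_trans[OF Vq(2) q(3)], of R] R by simp
    then have 2: "\<bar>V\<^sup>2 / q x / R\<bar> \<le> Y"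
      using R q(1) by simp
    have b2: "\<bar>c2 * (V\<^sup>2 / q x / R) / R\<bar> \<le> B * Y / R"
      unfolding abs_mult[of c2] abs_divide[of "_ * _" R] abs_of_pos[OF R] using c assms(3) 2 R
      by (intro divide_right_mono mult_mono) simp_all
    have "V\<^sup>2 / q x / (2 * q x) \<le> 2 * q x / (2 * q x)"
      using Vq q by (intro divide_right_mono) auto
    then have 1: "\<bar>V\<^sup>2 / q x / (2 * q x)\<bar> \<le> 1"
      using q Vq(1) by simp
    have b3: "\<bar>c1 * (V\<^sup>2 / q x / (2 * q x)) / R\<bar> \<le> B * 1 / R"
      unfolding abs_mult[of c1] abs_divide[of _ R] abs_of_pos[OF R] using c assms(3) 1 R
      by (intro divide_right_mono mult_mono) simp_all
    have tri: "\<bar>a + b - c\<bar> \<le> a' + b' + c'" if "\<bar>a\<bar> \<le> a'" "\<bar>b\<bar> \<le> b'" "\<bar>c\<bar> \<le> c'" for a b c a' b' c' :: real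
      using that by linarith
    show ?thesis
      unfolding e using tri[OF b1 b2 b3] by (simp add: add_divide_distrib)
  qed
  moreover have "\<bar>N x * (m * (c1 / R / S - c0 / (2 * q x * S)) * S / q x - 2 * m * (c1 / R / S) / S)\<bar>
      * cmod (snd x) \<le> B\<^sup>2 / R"
  proof -
    \<comment> \<open>The two contributions of the derivative of the cutoff to the second component
      are equal and cancel; only the undifferentiated cutoff remains.\<close>
    have "2 * m * (c1 / R / S) / S = m * (c1 / R) / q x"
    proof -
      have "2 * m * (c1 / R / S) / S = 2 * m * (c1 / R) / (S * S)"
        by simp
      then show ?thesis
        unfolding S(2) by simp
    qed
    moreover have "m * (c1 / R / S - c0 / (2 * q x * S)) * S / q x = m * (c1 / R) / q x - m * c0 / (2 * q x) / q x"
      using S(1) by (simp add: diff_divide_distrib right_diff_distrib left_diff_distrib)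
    ultimately have "\<bar>N x * (m * (c1 / R / S - c0 / (2 * q x * S)) * S / q x - 2 * m * (c1 / R / S) / S)\<bar>
      * cmod (snd x) = \<bar>m * c0 * (V / q x) / (2 * q x)\<bar>"
      using N q by (simp add: abs_mult V_def) (simp add: mult_ac)
    also have "\<dots> \<le> B * B * 1 / R"
    proof (rule bound)
      have "\<bar>V / q x\<bar> \<le> 1"
        using V q by simp
      then show "\<bar>m * c0 * (V / q x)\<bar> \<le> B * B * 1"
        unfolding abs_mult using c m assms(3)
        by (intro mult_mono mult_nonneg_nonneg abs_ge_zero) simp_all
    qed (use q in simp)
    finally show ?thesis by (simp add: power2_eq_square)
  qed
  moreover have "norm (dirac g (dirac g (radial_spinor Y R)) x) \<le>
      \<bar>m' * (c0 / S) / \<Lambda> x\<bar> + \<bar>m\<^sup>2 * (c0 / S) / S\<bar>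
      + 2 * \<bar>S * (2 * (c1 / R / S) + (c2 / R\<^sup>2 / S - c1 / R / (2 * q x * S)) * (V\<^sup>2 / q x))\<bar>
      + \<bar>N x * (m * (c1 / R / S - c0 / (2 * q x * S)) * S / q x - 2 * m * (c1 / R / S) / S)\<bar> * cmod (snd x)"
    (is "_ \<le> \<bar>?a\<bar> + \<bar>?b\<bar> + 2 * \<bar>?c\<bar> + \<bar>?d\<bar> * _")
  proof -
    have "norm (dirac g (dirac g (radial_spinor Y R)) x)
      = norm (vector [\<i> * of_real ?a + of_real ?b - 2 * of_real ?c, \<i> * of_real ?d * snd x] :: complex^2)"
      unfolding dirac_dirac_radial_spinor[OF R] V(3) c0_def c1_def c2_def m_def m'_def S_def by (rule refl)
    also have "\<dots> \<le> cmod (\<i> * of_real ?a + of_real ?b - 2 * of_real ?c) + cmod (\<i> * of_real ?d * snd x)"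
      by (rule norm_vector2_le)
    also have "cmod (\<i> * of_real ?d * snd x) = \<bar>?d\<bar> * cmod (snd x)"
      by (simp only: norm_mult norm_ii norm_of_real mult_1_left)
    also have "cmod (\<i> * of_real ?a + of_real ?b - 2 * of_real ?c)
      \<le> cmod (\<i> * of_real ?a) + cmod (of_real ?b) + cmod (2 * of_real ?c)"
      by (rule order_trans[OF norm_triangle_ineq4]) (intro add_mono norm_triangle_ineq order_refl)
    also have "\<dots> = \<bar>?a\<bar> + \<bar>?b\<bar> + 2 * \<bar>?c\<bar>"
      by (simp only: norm_mult norm_ii norm_of_real mult_1_left norm_numeral)
    finally show ?thesis
      by simp
  qed
  moreover have "B ^ 3 / R + B ^ 3 / R + 2 * ((3 * B + B * Y) / R) + B\<^sup>2 / R
      = (2 * B ^ 3 + 2 * (3 * B + B * Y) + B\<^sup>2) / R"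
    by (simp add: add_divide_distrib)
  ultimately show ?thesis
    by linarith
qed

section \<open>Norm estimates and the spectrum\<close>

definition V :: "chart measure" where "V = EH_volume t A \<Gamma> L"

lemma V_eq: "V = density lborel (\<lambda>x. ennreal (indicator ({0..<L} \<times> UNIV) x / \<Lambda> x))"
  unfolding V_def EH_volume_def riem_volume_def g_def[symmetric] volume_density by simp

lemma sets_V: "sets V = sets borel"
  by (simp add: V_eq)

lemma L2_sq_V:
  assumes "\<psi> \<in> borel_measurable borel"
  shows "L2_sq V \<psi> = (\<integral>\<^sup>+x. ennreal (indicator ({0..<L} \<times> UNIV) x * ((norm (\<psi> x))\<^sup>2 / \<Lambda> x)) \<partial>lborel)"
proof -
  have "{0..<L} \<times> (UNIV :: complex set) \<in> sets borel"
    by (intro borel_Times) auto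
  moreover have "\<Lambda> \<in> borel_measurable borel"
    by (intro borel_measurable_continuous_onI smooth_continuous_on smooth_\<Lambda>)
  ultimately have "(\<lambda>x. ennreal (indicator ({0..<L} \<times> UNIV) x / \<Lambda> x)) \<in> borel_measurable lborel"
    by measurable
  then have "L2_sq V \<psi> = (\<integral>\<^sup>+x. ennreal (indicator ({0..<L} \<times> UNIV) x / \<Lambda> x) * ennreal ((norm (\<psi> x))\<^sup>2) \<partial>lborel)"
    unfolding L2_sq_def V_eq using assms by (intro nn_integral_density) simp_all
  also have "\<dots> = (\<integral>\<^sup>+x. ennreal (indicator ({0..<L} \<times> UNIV) x * ((norm (\<psi> x))\<^sup>2 / \<Lambda> x)) \<partial>lborel)"
    using \<Lambda>_pos by (intro nn_integral_cong) (simp add: less_imp_le flip: ennreal_mult)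
  finally show ?thesis .
qed

lemma L2_sq_le:
  assumes "\<psi> \<in> borel_measurable borel" and "K \<ge> 0" and "r \<ge> 0"
    and "\<And>x. fst x \<in> {0..<L} \<Longrightarrow> \<psi> x \<noteq> 0 \<Longrightarrow> cmod (snd x) \<le> r \<and> (norm (\<psi> x))\<^sup>2 / \<Lambda> x \<le> K"
  shows "L2_sq V \<psi> \<le> ennreal (K * (L * (2 * r)\<^sup>2))"
proof -
  let ?C = "cbox (0, Complex (- r) (- r)) (L, Complex r r)"
  have "L2_sq V \<psi> \<le> (\<integral>\<^sup>+x. ennreal K * indicator ?C x \<partial>lborel)"
    unfolding L2_sq_V[OF assms(1)]
  proof (intro nn_integral_mono)
    fix x :: chart
    show "ennreal (indicator ({0..<L} \<times> UNIV) x * ((norm (\<psi> x))\<^sup>2 / \<Lambda> x)) \<le> ennreal K * indicator ?C x"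
    proof (cases "fst x \<in> {0..<L} \<and> \<psi> x \<noteq> 0")
      case True
      then have 1: "cmod (snd x) \<le> r" "(norm (\<psi> x))\<^sup>2 / \<Lambda> x \<le> K"
        using assms(4) by auto
      have "\<bar>Re (snd x)\<bar> \<le> r" "\<bar>Im (snd x)\<bar> \<le> r"
        using 1(1) abs_Re_le_cmod[of "snd x"] abs_Im_le_cmod[of "snd x"] by linarith+
      then have "x \<in> ?C"
        using True by (simp add: chart_box_iff abs_le_iff)
      then show ?thesis
        using True 1(2) by (auto simp: mem_Times_iff ennreal_leI)
    qed (auto simp: indicator_def)
  qed
  also have "\<dots> = ennreal K * emeasure lborel ?C"
    by (intro nn_integral_cmult_indicator) simp
  also have "\<dots> = ennreal (K * (L * (2 * r)\<^sup>2))"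
    using emeasure_chart_box(1)[of 0 L "- r" r "- r" r] L_pos assms(2,3)
    by (simp add: power2_eq_square mult.assoc flip: ennreal_mult)
  finally show ?thesis .
qed

text \<open>The box lies at distance at least 2 r from the zero section and has area r^2 in the
  fibre. With r = R it stays where the cutoff is bounded below, and its size is comparable to that
  of the square used for the upper bound.\<close>

lemma L2_sq_ge:
  assumes "\<psi> \<in> borel_measurable borel" and "K \<ge> 0" and "r \<ge> 0"
    and "\<And>x. fst x \<in> {0..<L} \<Longrightarrow> Re (snd x) \<in> {2 * r..3 * r} \<Longrightarrow> Im (snd x) \<in> {0..r} \<Longrightarrow>
      K \<le> (norm (\<psi> x))\<^sup>2 / \<Lambda> x"
  shows "ennreal (K * (L * r\<^sup>2)) \<le> L2_sq V \<psi>"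
proof -
  let ?C = "box (0, Complex (2 * r) 0) (L, Complex (3 * r) r)"
  have "ennreal (K * (L * r\<^sup>2)) = ennreal K * emeasure lborel ?C"
    using emeasure_chart_box(2)[of 0 L "2 * r" "3 * r" 0 r] L_pos assms(2,3)
    by (simp add: power2_eq_square mult.assoc flip: ennreal_mult)
  also have "\<dots> = (\<integral>\<^sup>+x. ennreal K * indicator ?C x \<partial>lborel)"
    by (intro nn_integral_cmult_indicator[symmetric]) simp
  also have "\<dots> \<le> L2_sq V \<psi>"
    unfolding L2_sq_V[OF assms(1)]
  proof (intro nn_integral_mono)
    fix x :: chart
    show "ennreal K * indicator ?C x \<le> ennreal (indicator ({0..<L} \<times> UNIV) x * ((norm (\<psi> x))\<^sup>2 / \<Lambda> x))"
    proof (cases "x \<in> ?C")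
      case True
      then have "fst x \<in> {0..<L}" "Re (snd x) \<in> {2 * r..3 * r}" "Im (snd x) \<in> {0..r}"
        by (simp_all add: chart_box_iff)
      with assms(4) True show ?thesis
        by (simp add: mem_Times_iff ennreal_leI)
    qed simp
  qed
  finally show ?thesis .
qed

lemma test_spinor_measurable: "test_spinor L \<psi> \<Longrightarrow> \<psi> \<in> borel_measurable borel"
  unfolding test_spinor_def by (intro borel_measurable_continuous_onI smooth_continuous_on) (rule conjunct1)

lemma test_spinor_L2:
  assumes "test_spinor L \<psi>"
  shows "\<psi> \<in> L2_space V"
proof -
  obtain R where R: "\<psi> (s, w) = 0" if "cmod w > R" for s w
    using assms by (auto simp: test_spinor_def)
  define r where "r = max R 0"
  let ?C = "{0..L} \<times> cball (0::complex) r"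
  have "smooth \<psi>"
    using assms by (simp add: test_spinor_def)
  note smooth_continuous_on[OF this] smooth_continuous_on[OF smooth_\<Lambda>]
  moreover have "\<Lambda> x \<noteq> 0" for x
    using \<Lambda>_pos[of x] by simp
  ultimately have "continuous_on ?C (\<lambda>x. (norm (\<psi> x))\<^sup>2 / \<Lambda> x)"
    by (intro continuous_on_divide continuous_on_power continuous_on_norm) auto
  then have "bounded ((\<lambda>x. (norm (\<psi> x))\<^sup>2 / \<Lambda> x) ` ?C)"
    by (intro compact_imp_bounded compact_continuous_image compact_Times) auto
  then obtain K where "\<forall>y\<in>(\<lambda>x. (norm (\<psi> x))\<^sup>2 / \<Lambda> x) ` ?C. norm y \<le> K"
    unfolding bounded_iff ..
  then have K: "\<bar>(norm (\<psi> x))\<^sup>2 / \<Lambda> x\<bar> \<le> K" if "x \<in> ?C" for x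
    using that by (simp only: ball_simps real_norm_def)
  have "L2_sq V \<psi> \<le> ennreal (max K 0 * (L * (2 * r)\<^sup>2))"
  proof (rule L2_sq_le[OF test_spinor_measurable[OF assms]])
    fix x :: chart assume "fst x \<in> {0..<L}" and "\<psi> x \<noteq> 0"
    moreover from this have "\<not> cmod (snd x) > R"
      using R[of "snd x" "fst x"] by auto
    then have "cmod (snd x) \<le> r"
      by (simp add: r_def)
    ultimately show "cmod (snd x) \<le> r \<and> (norm (\<psi> x))\<^sup>2 / \<Lambda> x \<le> max K 0"
      using K[of x] by (auto simp: mem_Times_iff abs_of_pos[OF \<Lambda>_pos])
  qed (auto simp: r_def)
  also have "\<dots> < \<infinity>"
    by simp
  finally show ?thesis
    using test_spinor_measurable[OF assms]
    by (simp add: L2_space_def measurable_cong_sets[OF sets_V refl])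
qed

lemma test_spinor_in_closure:
  assumes "test_spinor L \<psi>"
  shows "(\<psi>, dirac g \<psi>) \<in> EH_dirac_closure t A \<Gamma> L"
proof -
  have "(\<psi>, dirac g \<psi>) \<in> dirac_graph g L"
    using assms by (auto simp: dirac_graph_def)
  moreover have "L2_sq V (\<lambda>x. \<phi> x - \<phi> x) = 0" for \<phi> :: spinor
    by (simp add: L2_sq_def)
  ultimately have "\<exists>\<psi>' \<eta>'. (\<forall>n::nat. (\<psi>' n, \<eta>' n) \<in> dirac_graph g L) \<and>
      (\<lambda>n. L2_sq V (\<lambda>x. \<psi>' n x - \<psi> x)) \<longlonglongrightarrow> 0 \<and> (\<lambda>n. L2_sq V (\<lambda>x. \<eta>' n x - dirac g \<psi> x)) \<longlonglongrightarrow> 0"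
    by (intro exI[of _ "\<lambda>n. \<psi>"] exI[of _ "\<lambda>n. dirac g \<psi>"]) (simp only: tendsto_const simp_thms)
  then show ?thesis
    using test_spinor_L2[OF assms] test_spinor_L2[OF test_spinor_dirac[OF assms]]
    unfolding EH_dirac_closure_def V_def[symmetric] g_def[symmetric] L2_closure_def
    by (simp only: mem_Collect_eq case_prod_conv simp_thms)
qed

lemma norm_radial_spinor: "norm (radial_spinor Y R x) = \<bar>cutoff Y (q x / R)\<bar>"
  by (simp add: radial_spinor_def norm_vec_def L2_set_def sum_2)

lemma inverse_\<Lambda>: "1 / \<Lambda> x = N x / sqrt (2 * q x)"
  by (simp add: \<Lambda>_def)

text \<open>The upper bound for the image and the lower bound for the spinor contain the same power
  of R from the volume. The pointwise factor 1/R of the square, itself squared, makes their quotient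
  O(1 / R^2).\<close>

lemma dirac_sq_not_bounded_below:
  assumes "C \<ge> 0"
  shows "\<exists>\<psi>. test_spinor L \<psi> \<and> ennreal C * L2_sq V (dirac g (dirac g \<psi>)) < L2_sq V \<psi>"
proof -
  obtain B0 where B0: "B0 \<ge> 1"
    "\<And>x. fst x \<in> {0..<L} \<Longrightarrow> N x \<le> B0 \<and> \<bar>M (fst x)\<bar> \<le> B0 \<and> \<bar>M' (fst x)\<bar> \<le> B0"
    by (rule bound_on_period) blast
  \<comment> \<open>On the box of \<open>L2_sq_ge\<close> one has \<open>2 \<le> q / R \<le> 4 B0 = Y - 1\<close>, where the cutoff is at least \<open>1 / e\<close>.\<close>
  define Y where "Y = 4 * B0 + 1"
  have Y: "Y \<ge> 1"
    using B0(1) by (simp add: Y_def)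
  obtain B1 where B1: "\<And>y. \<bar>cutoff Y y\<bar> \<le> B1 \<and> \<bar>cutoff' Y y\<bar> \<le> B1 \<and> \<bar>cutoff'' Y y\<bar> \<le> B1"
    by (rule cutoff_bound[OF Y]) blast
  \<comment> \<open>The order of choice matters: \<open>B0\<close> depends on the curve only and
    fixes \<open>Y\<close>; \<open>B1\<close> depends on \<open>Y\<close>. Only then can both be
    merged, and \<open>R\<close> comes last.\<close>
  define B where "B = max B0 B1"
  have B: "B \<ge> 1" "\<bar>cutoff Y y\<bar> \<le> B" "\<bar>cutoff' Y y\<bar> \<le> B" "\<bar>cutoff'' Y y\<bar> \<le> B" for y
    using B0(1) B1[of y] by (auto simp: B_def)
  have B': "N x \<le> B" "\<bar>M (fst x)\<bar> \<le> B" "\<bar>M' (fst x)\<bar> \<le> B" if "fst x \<in> {0..<L}" for x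
    using B0(2)[OF that] by (auto simp: B_def)
  define K where "K = 2 * B ^ 3 + 2 * (3 * B + B * Y) + B\<^sup>2"
  \<comment> \<open>\<open>Q / R\<^sup>2\<close> is exactly the quotient of the two bounds,
    including \<open>C\<close>. The factor \<open>4 * Y\<^sup>2\<close> is the area of the large
    square in units of R^2, \<open>sqrt Y\<close> comes from the density at q \<le> Y R, and
    \<open>exp (- 1)\<close> from \<open>cutoff_ge\<close>.\<close>
  define Q where "Q = C * K\<^sup>2 * B * 4 * Y\<^sup>2 * sqrt Y / (exp (- 1))\<^sup>2"
  \<comment> \<open>R \<ge> 1 turns R > Q into R^2 > Q; R \<ge> t^2 makes the t^4 in q^2 at most
    R^2.\<close>
  define R where "R = max 1 (max (t\<^sup>2) (Q + 1))"
  have R: "R \<ge> 1" "R \<ge> t\<^sup>2" "R > Q"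
    by (auto simp: R_def)
  then have R0: "R > 0" by simp
  let ?\<psi> = "radial_spinor Y R" and ?s = "sqrt (2 * R)"
  have s: "?s > 0"
    using R0 by simp
  define K1 where "K1 = (K / R)\<^sup>2 * (B / ?s)"
  define K2 where "K2 = (exp (- 1))\<^sup>2 * (1 / (sqrt Y * ?s))"
  note ts = test_spinor_radial_spinor[OF R0 Y]
  note ts2 = test_spinor_dirac[OF test_spinor_dirac[OF ts]]
  have "L2_sq V (dirac g (dirac g ?\<psi>)) \<le> ennreal (K1 * (L * (2 * (Y * R))\<^sup>2))"
  proof (rule L2_sq_le[OF test_spinor_measurable[OF ts2]])
    fix x :: chart assume x: "fst x \<in> {0..<L}" and "dirac g (dirac g ?\<psi>) x \<noteq> 0"
    then have "q x / R \<in> {1..Y}"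
      using dirac_dirac_radial_spinor_eq_0[OF R0 Y] by blast
    then have q: "R \<le> q x" "q x \<le> Y * R"
      using R0 by (auto simp: field_simps)
    have "norm (dirac g (dirac g ?\<psi>) x) \<le> K / R"
      unfolding K_def by (rule norm_dirac_dirac_radial_spinor_le) (use R Y B B'[OF x] in auto)
    then have "(norm (dirac g (dirac g ?\<psi>) x))\<^sup>2 \<le> (K / R)\<^sup>2"
      by (intro power_mono) auto
    moreover have "1 / \<Lambda> x \<le> B / ?s"
      unfolding inverse_\<Lambda> using B'(1)[OF x] N_pos[of x] q s B(1) by (intro frac_le) auto
    ultimately have "(norm (dirac g (dirac g ?\<psi>) x))\<^sup>2 * (1 / \<Lambda> x) \<le> K1"
      unfolding K1_def using \<Lambda>_pos[of x] by (intro mult_mono) auto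
    then show "cmod (snd x) \<le> Y * R \<and> (norm (dirac g (dirac g ?\<psi>) x))\<^sup>2 / \<Lambda> x \<le> K1"
      using q_ge(2)[of x] q(2) by simp
  qed (use s B(1) Y R0 in \<open>auto simp: K1_def\<close>)
  then have "ennreal C * L2_sq V (dirac g (dirac g ?\<psi>)) \<le> ennreal C * ennreal (K1 * (L * (2 * (Y * R))\<^sup>2))"
    by (intro mult_left_mono) auto
  also have "\<dots> = ennreal (C * (K1 * (L * (2 * (Y * R))\<^sup>2)))"
    using assms s B(1) L_pos by (intro ennreal_mult[symmetric]) (auto simp: K1_def)
  also have "\<dots> < ennreal (K2 * (L * R\<^sup>2))"
  proof (rule ennreal_lessI)
    have c: "L * R\<^sup>2 / ?s * ((exp (- 1))\<^sup>2 / sqrt Y) > 0"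
      using L_pos R0 s Y by simp
    have "R * 1 \<le> R * R"
      using R by (intro mult_left_mono) auto
    then have "Q < R\<^sup>2"
      unfolding power2_eq_square using R(3) by linarith
    then have "Q / R\<^sup>2 < 1"
      using R0 by simp
    have "sqrt Y > 0"
      using Y by simp
    then have "C * (K1 * (L * (2 * (Y * R))\<^sup>2)) = L * R\<^sup>2 / ?s * ((exp (- 1))\<^sup>2 / sqrt Y) * (Q / R\<^sup>2)"
      unfolding K1_def Q_def using s R0 by (simp add: power_divide power_mult_distrib)
    also have "\<dots> < L * R\<^sup>2 / ?s * ((exp (- 1))\<^sup>2 / sqrt Y) * 1"
      using \<open>Q / R\<^sup>2 < 1\<close> c by (rule mult_strict_left_mono)
    also have "\<dots> = K2 * (L * R\<^sup>2)"
      by (simp add: K2_def mult_ac)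
    finally show "C * (K1 * (L * (2 * (Y * R))\<^sup>2)) < K2 * (L * R\<^sup>2)" .
    show "0 < K2 * (L * R\<^sup>2)"
      using L_pos R0 s Y by (simp add: K2_def)
  qed
  also have "\<dots> \<le> L2_sq V ?\<psi>"
  proof (rule L2_sq_ge[OF test_spinor_measurable[OF ts]])
    fix x :: chart
    assume x: "fst x \<in> {0..<L}" "Re (snd x) \<in> {2 * R..3 * R}" "Im (snd x) \<in> {0..R}"
    have "t ^ 4 = (t\<^sup>2)\<^sup>2"
      by simp
    also have "\<dots> \<le> R\<^sup>2"
      using R(2) by (intro power_mono) auto
    finally have t4: "t ^ 4 \<le> R\<^sup>2" .
    have w: "snd x \<bullet> snd x = (Re (snd x))\<^sup>2 + (Im (snd x))\<^sup>2"
      by (simp add: inner_complex_def power2_eq_square)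
    have re: "(2 * R)\<^sup>2 \<le> (Re (snd x))\<^sup>2" "(Re (snd x))\<^sup>2 \<le> (3 * R)\<^sup>2" "(Im (snd x))\<^sup>2 \<le> R\<^sup>2"
      by (rule power_mono, use x R0 in simp, use x R0 in simp)+
    have "1 * (2 * R)\<^sup>2 \<le> (N x)\<^sup>2 * (snd x \<bullet> snd x)"
      using re N_ge_1[of x] unfolding w by (intro mult_mono) (auto simp: one_le_power intro: add_increasing2)
    then have "(2 * R)\<^sup>2 \<le> (q x)\<^sup>2"
      unfolding q_sq by (simp add: add_increasing2)
    then have q1: "2 * R \<le> q x"
      by (rule power2_le_imp_le) (simp add: less_imp_le[OF q_pos])
    have "(N x)\<^sup>2 * (snd x \<bullet> snd x) \<le> B0\<^sup>2 * (10 * R\<^sup>2)"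
      using re B0(2)[OF x(1)] N_pos[of x] unfolding w
      by (intro mult_mono power_mono) (auto simp: power_mult_distrib less_imp_le)
    moreover have "1 * R\<^sup>2 \<le> B0\<^sup>2 * R\<^sup>2"
      using B0(1) by (intro mult_right_mono) (auto simp: one_le_power)
    \<comment> \<open>9 + 1 from the real and imaginary parts of w and 1 from t^4 give 11, which is
      below 16 = 4^2.\<close>
    moreover have "B0\<^sup>2 * (10 * R\<^sup>2) = 10 * (B0\<^sup>2 * R\<^sup>2)" "(4 * B0 * R)\<^sup>2 = 16 * (B0\<^sup>2 * R\<^sup>2)"
      "0 \<le> B0\<^sup>2 * R\<^sup>2"
      by (simp_all add: power_mult_distrib)
    ultimately have "(q x)\<^sup>2 \<le> (4 * B0 * R)\<^sup>2"
      unfolding q_sq using t4 by linarith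
    then have q2: "q x \<le> 4 * B0 * R"
      by (rule power2_le_imp_le) (use B0(1) R0 in simp)
    have "exp (- 1) \<le> cutoff Y (q x / R)"
      using q1 q2 R0 by (intro cutoff_ge) (auto simp: field_simps Y_def)
    then have "(exp (- 1))\<^sup>2 \<le> (norm (?\<psi> x))\<^sup>2"
      unfolding norm_radial_spinor by (intro power_mono) auto
    moreover have "1 / (sqrt Y * ?s) \<le> 1 / \<Lambda> x"
    proof -
      have "q x \<le> Y * R"
        using q2 R0 by (simp add: Y_def algebra_simps)
      then have "sqrt (2 * q x) \<le> sqrt Y * ?s"
        by (simp flip: real_sqrt_mult)
      then show ?thesis
        unfolding inverse_\<Lambda> using q_pos[of x] N_ge_1[of x] by (intro frac_le) auto
    qed
    ultimately have "K2 \<le> (norm (?\<psi> x))\<^sup>2 * (1 / \<Lambda> x)"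
      unfolding K2_def using s Y by (intro mult_mono) auto
    then show "K2 \<le> (norm (?\<psi> x))\<^sup>2 / \<Lambda> x"
      by simp
  qed (use s Y R0 in \<open>auto simp: K2_def\<close>)
  finally show ?thesis
    using ts by blast
qed

section \<open>Zero in the spectra of the operator and of its square\<close>

lemma zero_in_spectrum_dirac_sq:
  "0 \<in> L2_spectrum V (EH_dirac_closure t A \<Gamma> L O EH_dirac_closure t A \<Gamma> L)"
proof (rule ccontr)
  let ?D = "EH_dirac_closure t A \<Gamma> L"
  assume "\<not> ?thesis"
  then obtain C where C: "\<forall>(\<psi>, \<eta>)\<in>?D O ?D. L2_sq V \<psi> \<le> ennreal C * L2_sq V (\<lambda>x. \<eta> x - 0 *s \<psi> x)"
    unfolding L2_spectrum_def L2_resolvent_set_def by blast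
  \<comment> \<open>The constant of the resolvent set may be negative, and then
    \<open>ennreal C\<close> is 0; hence the maximum with 0.\<close>
  obtain \<psi> where \<psi>: "test_spinor L \<psi>" "ennreal (max C 0) * L2_sq V (dirac g (dirac g \<psi>)) < L2_sq V \<psi>"
    using dirac_sq_not_bounded_below[of "max C 0"] by auto
  have "(\<psi>, dirac g (dirac g \<psi>)) \<in> ?D O ?D"
    using test_spinor_in_closure[OF \<psi>(1)] test_spinor_in_closure[OF test_spinor_dirac[OF \<psi>(1)]] by blast
  with C have "L2_sq V \<psi> \<le> ennreal C * L2_sq V (dirac g (dirac g \<psi>))"
    by fastforce
  with \<psi>(2) show False
    by (simp add: max_def ennreal_neg split: if_splits)
qed

text \<open>If the operator were bounded below with constant C, applying the bound to \<psi> and to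
  \<open>dirac g \<psi>\<close> would bound the square below with constant C^2.\<close>

lemma zero_in_spectrum_dirac: "0 \<in> L2_spectrum V (EH_dirac_closure t A \<Gamma> L)"
proof (rule ccontr)
  let ?D = "EH_dirac_closure t A \<Gamma> L"
  assume "\<not> ?thesis"
  then obtain C where C: "\<forall>(\<psi>, \<eta>)\<in>?D. L2_sq V \<psi> \<le> ennreal C * L2_sq V (\<lambda>x. \<eta> x - 0 *s \<psi> x)"
    unfolding L2_spectrum_def L2_resolvent_set_def by blast
  have C': "L2_sq V \<psi> \<le> ennreal (max C 0) * L2_sq V (dirac g \<psi>)" if "test_spinor L \<psi>" for \<psi>
    using C test_spinor_in_closure[OF that] by (fastforce simp: max_def ennreal_neg)
  obtain \<psi> where \<psi>: "test_spinor L \<psi>"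
    "ennreal (max C 0 * max C 0) * L2_sq V (dirac g (dirac g \<psi>)) < L2_sq V \<psi>"
    using dirac_sq_not_bounded_below[of "max C 0 * max C 0"] by auto
  have "L2_sq V \<psi> \<le> ennreal (max C 0) * L2_sq V (dirac g \<psi>)"
    by (rule C'[OF \<psi>(1)])
  also have "\<dots> \<le> ennreal (max C 0) * (ennreal (max C 0) * L2_sq V (dirac g (dirac g \<psi>)))"
    by (intro mult_left_mono C'[OF test_spinor_dirac[OF \<psi>(1)]]) simp
  also have "\<dots> = ennreal (max C 0 * max C 0) * L2_sq V (dirac g (dirac g \<psi>))"
    by (simp add: ennreal_mult mult.assoc)
  finally show False
    using \<psi>(2) by simp
qed

end

theorem theorem4:
  fixes \<Gamma> :: "real \<Rightarrow> complex" and L t :: real and A :: "complex^2^2"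
  assumes "closed_curve \<Gamma> L" and "t \<noteq> 0" and "unitary A"
  defines "M \<equiv> EH_volume t A \<Gamma> L" and "D \<equiv> EH_dirac_closure t A \<Gamma> L"
  shows "(\<forall>\<delta>>0. (INF \<mu>\<in>{\<mu>::real. complex_of_real \<mu> \<in> L2_spectrum M (D O D)}. ereal \<mu>) < ereal \<delta>)
         \<and> 0 \<in> L2_spectrum M D"
proof (intro conjI allI impI)
  interpret EH: EH_curve \<Gamma> L t A
    using assms(1-3) by (rule EH_curve.intro)
  show "0 \<in> L2_spectrum M D"
    using EH.zero_in_spectrum_dirac by (simp add: M_def D_def EH.V_def)
  fix \<delta> :: real assume "\<delta> > 0"
  have "0 \<in> {\<mu>::real. complex_of_real \<mu> \<in> L2_spectrum M (D O D)}"
    using EH.zero_in_spectrum_dirac_sq by (simp add: M_def D_def EH.V_def)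
  then have "(INF \<mu>\<in>{\<mu>::real. complex_of_real \<mu> \<in> L2_spectrum M (D O D)}. ereal \<mu>) \<le> ereal 0"
    by (rule INF_lower)
  also have "\<dots> < ereal \<delta>"
    using \<open>\<delta> > 0\<close> by simp
  finally show "(INF \<mu>\<in>{\<mu>::real. complex_of_real \<mu> \<in> L2_spectrum M (D O D)}. ereal \<mu>) < ereal \<delta>" .
qed

end
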